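(* Let $N\in\{2,4,6,\dots\}$ be even, let $r_1,e,d$ be arbitrary positive parameters, and put $$r_2=r_1+e+\tfrac N2,\qquad \rho_1=r_1+e+d+\tfrac{N-1}{2},\qquad \rho_2=r_1+e-\tfrac12,$$ so that $2(r_2-\rho_2)=N+1$. Let $P_n$ be the monic Bannai-Ito polynomials with these parameters, with recurrence relation $P_{n+1}+b_nP_n+u_nP_{n-1}=xP_n$. Then $$u_n=\frac{n(n+4r_1-2+4e+2d+N)(-n+4r_1+2e+N)(n-2+2e+2d)}{16(n-1+e+d)^2}\quad(n=2,4,\dots,N),$$ $$u_n=\frac{(n-1+2e+2d+N)(n-1+2d)(n-1+2e)(-n+1+N)}{16(n-1+e+d)^2}\quad(n=1,3,\dots,N-1),$$ so $u_n>0$ for $n=1,\dots,N$, while $u_{N+1}=0$. The roots of $P_{N+1}$ are the distinct points $$x_s=-\tfrac14+(-1)^s\left(\rho_2+\tfrac14+\tfrac s2\right),\qquad s=0,1,\dots,N,$$ and the polynomials satisfy $$\sum_{s=0}^Nw_sP_n(x_s)P_m(x_s)=\kappa_n^2\,\delta_{nm},\qquad n,m=0,1,\dots,N,$$ with some normalization constants $\kappa_n$ and positive weights $w_s=\varphi(x_s)>0$, where the symmetry factor $\varphi$ can be taken in the form $$\varphi(x)=-2\sigma_0(x)\,\frac{\Gamma(\rho_1-x)\,\Gamma(x-r_1+\frac12)\,\Gamma(-x-r_1+\frac12)\,\Gamma(x+1+\rho_1)}{\Gamma(x+1-\rho_2)\,\Gamma(x+r_2+\frac12)\,\Gamma(r_2+\frac12-x)\,\Gamma(-x-\rho_2)}$$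 with $\sigma_0$ odd and 1-periodic, so that on the grid $\sigma_0(x_s)=(-1)^s\,\mathrm{const}$ (the constant being chosen so that the weights are positive).
   Context: For real parameters $r_1,r_2,\rho_1,\rho_2$ the Dunkl shift operator $L$ acts by $$Lf(x)=F(x)(f(x)-f(-x))+G(x)(f(-x-1)-f(x)),\quad F(x)=\frac{(x-\rho_1)(x-\rho_2)}{2x},\quad G(x)=\frac{(x-r_1+1/2)(x-r_2+1/2)}{2x+1}.$$ It maps polynomials to polynomials and $Lx^n=\lambda_nx^n+O(x^{n-1})$ with $\lambda_n=n/2$ for even $n$ and $\lambda_n=r_1+r_2-\rho_1-\rho_2-(n+1)/2$ for odd $n$. The $\lambda_n$ being pairwise distinct (true for the parameters above), the monic Bannai-Ito polynomial $P_n$ is the unique monic polynomial of degree $n$ with $LP_n=\lambda_nP_n$. For general parameters, with $g=\rho_1+\rho_2-r_1-r_2$, the recurrence coefficients are $$u_n=-\frac{n(n+2\rho_1+2\rho_2)(n-2r_1-2r_2)(n+2g)}{16(n+g)^2}\ (n\text{ even}),$$ $$u_n=-\frac{(n+2\rho_1-2r_1)(n+2\rho_1-2r_2)(n+2\rho_2-2r_1)(n+2\rho_2-2r_2)}{16(n+g)^2}\ (n\text{ odd}).$$ A symmetry factor is a function $\varphi$ for which $\varphi L$ is formally self-adjoint, i.e. $\varphi(-x)F(-x)=\varphi(x)F(x)$ and $\varphi(-x-1)G(-x-1)=\varphi(x)G(x)$; the Gamma-function expression for it is constructed for generic values of the parameters $r_1,r_2,\rho_1,\rho_2$.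
   Formalization: The Gamma form of φ is claimed only when 2r_1+e and 2r_1+2e are not integers (otherwise the formula has a pole at x_0, or σ_0 vanishes on the grid); all other claims, including existence of positive symmetry-factor weights, hold for all positive r_1, e, d. *)

theory Defs
  imports "HOL-Analysis.Analysis" "HOL-Computational_Algebra.Polynomial"
begin

definition dunkl_F :: "real \<Rightarrow> real \<Rightarrow> real \<Rightarrow> real" where
  "dunkl_F \<rho>1 \<rho>2 x = (x - \<rho>1) * (x - \<rho>2) / (2 * x)"

definition dunkl_G :: "real \<Rightarrow> real \<Rightarrow> real \<Rightarrow> real" where
  "dunkl_G r1 r2 x = (x - r1 + 1/2) * (x - r2 + 1/2) / (2 * x + 1)"

definition dunkl_shift ::
  "real \<Rightarrow> real \<Rightarrow> real \<Rightarrow> real \<Rightarrow> (real \<Rightarrow> real) \<Rightarrow> real \<Rightarrow> real" where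
  "dunkl_shift r1 r2 \<rho>1 \<rho>2 f x =
     dunkl_F \<rho>1 \<rho>2 x * (f x - f (- x)) + dunkl_G r1 r2 x * (f (- x - 1) - f x)"

definition bi_eigenvalue :: "real \<Rightarrow> real \<Rightarrow> real \<Rightarrow> real \<Rightarrow> nat \<Rightarrow> real" where
  "bi_eigenvalue r1 r2 \<rho>1 \<rho>2 n =
     (if even n then real n / 2 else r1 + r2 - \<rho>1 - \<rho>2 - (real n + 1) / 2)"

(* The eigenvalue equation is an identity of polynomials. It is required off the removable
   singularities 0 and -1/2 of F and G, where division by zero would distort the operator;
   two polynomials that agree off two points are equal, so nothing is lost. *)
definition is_bannai_ito ::
  "real \<Rightarrow> real \<Rightarrow> real \<Rightarrow> real \<Rightarrow> nat \<Rightarrow> real poly \<Rightarrow> bool" where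
  "is_bannai_ito r1 r2 \<rho>1 \<rho>2 n p \<longleftrightarrow>
     degree p = n \<and> lead_coeff p = 1 \<and>
     (\<forall>x. x \<noteq> 0 \<longrightarrow> x \<noteq> -1/2 \<longrightarrow>
        dunkl_shift r1 r2 \<rho>1 \<rho>2 (poly p) x = bi_eigenvalue r1 r2 \<rho>1 \<rho>2 n * poly p x)"

definition bannai_ito :: "real \<Rightarrow> real \<Rightarrow> real \<Rightarrow> real \<Rightarrow> nat \<Rightarrow> real poly" where
  "bannai_ito r1 r2 \<rho>1 \<rho>2 n = (THE p. is_bannai_ito r1 r2 \<rho>1 \<rho>2 n p)"

(* The value at n = 0 is 0. *)
definition bi_u :: "real \<Rightarrow> real \<Rightarrow> real \<Rightarrow> real \<Rightarrow> nat \<Rightarrow> real" where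
  "bi_u r1 r2 \<rho>1 \<rho>2 n =
     (let g = \<rho>1 + \<rho>2 - r1 - r2 in
      if even n
      then - (real n * (real n + 2 * \<rho>1 + 2 * \<rho>2) * (real n - 2 * r1 - 2 * r2) * (real n + 2 * g))
             / (16 * (real n + g)\<^sup>2)
      else - ((real n + 2 * \<rho>1 - 2 * r1) * (real n + 2 * \<rho>1 - 2 * r2)
               * (real n + 2 * \<rho>2 - 2 * r1) * (real n + 2 * \<rho>2 - 2 * r2))
             / (16 * (real n + g)\<^sup>2))"

definition bi_grid :: "real \<Rightarrow> nat \<Rightarrow> real" where
  "bi_grid \<rho>2 s = - 1/4 + (-1) ^ s * (\<rho>2 + 1/4 + real s / 2)"

(* Formal self-adjointness of phi L, required at the points of D whose mirror image is also
   in D. At the poles x = 0 and x = -1/2 of F and G both sides coincide trivially. *)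
definition symmetry_factor_on ::
  "real set \<Rightarrow> real \<Rightarrow> real \<Rightarrow> real \<Rightarrow> real \<Rightarrow> (real \<Rightarrow> real) \<Rightarrow> bool" where
  "symmetry_factor_on D r1 r2 \<rho>1 \<rho>2 \<phi> \<longleftrightarrow>
     (\<forall>x\<in>D. - x \<in> D \<longrightarrow> \<phi> (- x) * dunkl_F \<rho>1 \<rho>2 (- x) = \<phi> x * dunkl_F \<rho>1 \<rho>2 x) \<and>
     (\<forall>x\<in>D. - x - 1 \<in> D \<longrightarrow>
        \<phi> (- x - 1) * dunkl_G r1 r2 (- x - 1) = \<phi> x * dunkl_G r1 r2 x)"

(* Gamma and division return 0 at poles and for zero divisors, so a pole of a Gamma function
   in the denominator correctly gives the value 0. *)
definition bi_gamma_factor ::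
  "(real \<Rightarrow> real) \<Rightarrow> real \<Rightarrow> real \<Rightarrow> real \<Rightarrow> real \<Rightarrow> real \<Rightarrow> real" where
  "bi_gamma_factor \<sigma> r1 r2 \<rho>1 \<rho>2 x =
     - 2 * \<sigma> x *
       (Gamma (\<rho>1 - x) * Gamma (x - r1 + 1/2) * Gamma (- x - r1 + 1/2) * Gamma (x + 1 + \<rho>1)) /
       (Gamma (x + 1 - \<rho>2) * Gamma (x + r2 + 1/2) * Gamma (r2 + 1/2 - x) * Gamma (- x - \<rho>2))"

(* The points at which no Gamma function in the numerator has a pole. *)
definition bi_gamma_regular :: "real \<Rightarrow> real \<Rightarrow> real set" where
  "bi_gamma_regular r1 \<rho>1 =
     {x. \<rho>1 - x \<notin> \<int>\<^sub>\<le>\<^sub>0 \<and> x - r1 + 1/2 \<notin> \<int>\<^sub>\<le>\<^sub>0 \<and> - x - r1 + 1/2 \<notin> \<int>\<^sub>\<le>\<^sub>0 \<and> x + 1 + \<rho>1 \<notin> \<int>\<^sub>\<le>\<^sub>0}"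

definition odd_one_periodic :: "(real \<Rightarrow> real) \<Rightarrow> bool" where
  "odd_one_periodic \<sigma> \<longleftrightarrow> (\<forall>x. \<sigma> (- x) = - \<sigma> x) \<and> (\<forall>x. \<sigma> (x + 1) = \<sigma> x)"

definition orthogonal_on_grid ::
  "nat \<Rightarrow> (nat \<Rightarrow> real) \<Rightarrow> (nat \<Rightarrow> real) \<Rightarrow> (nat \<Rightarrow> real poly) \<Rightarrow> bool" where
  "orthogonal_on_grid N x w P \<longleftrightarrow>
     (\<exists>\<kappa>. (\<forall>n\<le>N. \<kappa> n > 0) \<and>
       (\<forall>n\<le>N. \<forall>m\<le>N. (\<Sum>s\<le>N. w s * poly (P n) (x s) * poly (P m) (x s)) =
          (if n = m then (\<kappa> n)\<^sup>2 else (0::real))))"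

end

theory Submission
  imports Defs
begin

text \<open>
  The Dunkl shift operator $L$ is triangular on polynomials, with the pairwise distinct diagonal
  entries $\lambda_n$; this alone gives existence and uniqueness of the polynomials $P_n$
  (\<open>ex1_bannai_ito\<close>), and it makes every eigenpolynomial a multiple of some $P_n$
  (\<open>eigenvector_eq\<close>).  The other
  main claims come down to recognizing eigenpolynomials.

  Recurrence.  Let $S = Lx - xL$ be the commutator of $L$ with multiplication by $x$; it has
  polynomial coefficients.  If $Lf = \lambda f$, then $L S f$ is a combination of $Sf$, $xf$ and $f$
  (\<open>L_commutator\<close>).  This is one of the relations of the Bannai-Ito algebra, restricted to an
  eigenspace.  For $f = P_n$ it reads
  $(L - \lambda_{n+1})(L - \lambda_{n-1})(xP_n) = \kappa P_n$, so that $xP_n$ lies in the span of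
  $P_{n+1}$, $P_n$ and $P_{n-1}$ (\<open>three_terms\<close>).  The coefficient $u_n$ is then read off from the
  three leading coefficients of $P_n$, which depend only on the main diagonal and the first two
  subdiagonals of $L$ (\<open>eq_bi_uI\<close>).

  Truncation.  The reflections $x \mapsto -x-1$ and $x \mapsto -x$ move alternately from each
  grid point to the next one, and $F(x_0) = 0 = G(x_N)$ cuts this chain at both ends.  On the grid, $L$
  is therefore a finite tridiagonal operator (\<open>L_grid\<close>).  Two consequences follow.  First,
  $Q = \prod_{s \le N} (x - x_s)$ is an eigenpolynomial of degree $N+1$, because $LQ$ vanishes on the grid
  too; hence $Q = P_{N+1}$ (\<open>P_Suc_N\<close>).  Second, $L$ is self-adjoint on the grid
  for any weights that satisfy the detailed balance condition \<open>balanced\<close>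
  (\<open>L_self_adjoint\<close>), and eigenpolynomials with different eigenvalues are orthogonal.  Across
  each link of the chain the two off-diagonal entries have the same sign (\<open>link_neg\<close>), so balanced weights are positive as
  soon as the first one is.

  A symmetry factor restricts to balanced weights.  For the Gamma expression, the symmetry follows
  from the functional equation of $\Gamma$ (\<open>bi_gamma_factor_F\<close>, \<open>bi_gamma_factor_G\<close>), and only
  its value at $x_0$ matters for the sign.  For arbitrary parameters, at which the Gamma functions
  may have poles, the weights are defined along the chain and extended by zero (\<open>grid_factor\<close>).
\<close>

section \<open>The operator on polynomials\<close>

lemma poly_eq_off_finite:
  fixes p q :: "real poly"
  assumes "finite A" "\<And>x. x \<notin> A \<Longrightarrow> poly p x = poly q x"
  shows "p = q"
proof (rule ccontr)
  assume "p \<noteq> q"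
  then have "finite {x. poly (p - q) x = 0}"
    by (intro poly_roots_finite) simp
  moreover have "- A \<subseteq> {x. poly (p - q) x = 0}"
    using assms(2) by auto
  ultimately have "finite (- A)"
    by (rule finite_subset [rotated])
  with assms(1) show False
    by (metis finite_compl infinite_UNIV_char_0)
qed

locale dunkl =
  fixes r1 r2 \<rho>1 \<rho>2 :: real
begin

abbreviation shift :: "(real \<Rightarrow> real) \<Rightarrow> real \<Rightarrow> real" where
  "shift \<equiv> dunkl_shift r1 r2 \<rho>1 \<rho>2"

abbreviation ev :: "nat \<Rightarrow> real" where
  "ev \<equiv> bi_eigenvalue r1 r2 \<rho>1 \<rho>2"

definition g :: real where
  "g = \<rho>1 + \<rho>2 - r1 - r2"

text \<open>
  The commutator of L with multiplication by x (see \<open>L_times_x\<close>).  The denominators of F and G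
  cancel against x - (-x) = 2 x and (-x-1) - x = -(2 x + 1), so it preserves polynomials.
\<close>

definition commutator :: "real poly \<Rightarrow> real poly" where
  "commutator p = [:\<rho>1 * \<rho>2, - (\<rho>1 + \<rho>2), 1:] * pcompose p [:0, -1:]
     - [:(r1 - 1/2) * (r2 - 1/2), 1 - r1 - r2, 1:] * pcompose p [:-1, -1:]"

text \<open>
  Building L from the commutator makes its polynomiality evident and turns statements on its matrix
  entries into inductions on the exponent.
\<close>

primrec L_monom :: "nat \<Rightarrow> real poly" where
  "L_monom 0 = 0"
| "L_monom (Suc n) = [:0, 1:] * L_monom n + commutator (monom 1 n)"

definition L :: "real poly \<Rightarrow> real poly" where
  "L p = (\<Sum>i\<le>degree p. smult (coeff p i) (L_monom i))"

lemma poly_commutator: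
  "poly (commutator p) x = (x - \<rho>1) * (x - \<rho>2) * poly p (- x)
     - (x - r1 + 1/2) * (x - r2 + 1/2) * poly p (- x - 1)"
proof -
  have "poly (commutator p) x = (\<rho>1 * \<rho>2 + x * (x - (\<rho>1 + \<rho>2))) * poly p (- x)
     - ((r1 - 1/2) * (r2 - 1/2) + x * (x + (1 - r1 - r2))) * poly p (- x - 1)"
  proof -
    have "poly p (- 1 - x) = poly p (- x - 1)"
      by (rule arg_cong [of _ _ "poly p"]) simp
    then show ?thesis
      by (simp add: commutator_def poly_pcompose) (simp add: ring_distribs)
  qed
  moreover have "\<rho>1 * \<rho>2 + x * (x - (\<rho>1 + \<rho>2)) = (x - \<rho>1) * (x - \<rho>2)"
    "(r1 - 1/2) * (r2 - 1/2) + x * (x + (1 - r1 - r2)) = (x - r1 + 1/2) * (x - r2 + 1/2)"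
    by (simp_all add: field_simps)
  ultimately show ?thesis
    by simp
qed

text \<open>
  At the pole x = 0 of F the identity survives if \<rho>1 * \<rho>2 = 0: the lost term carries
  this factor.  This case is needed when the grid contains 0, which happens exactly for \<rho>2 = 0.
\<close>

lemma shift_times_x:
  assumes "x \<noteq> -1/2" "x \<noteq> 0 \<or> \<rho>1 * \<rho>2 = 0"
  shows "shift (\<lambda>y. y * f y) x
     = x * shift f x + (x - \<rho>1) * (x - \<rho>2) * f (- x) - (x - r1 + 1/2) * (x - r2 + 1/2) * f (- x - 1)"
proof -
  have "2 * x + 1 \<noteq> 0"
    using assms(1) by linarith
  then have G: "(2 * x + 1) * dunkl_G r1 r2 x = (x - r1 + 1/2) * (x - r2 + 1/2)"
    unfolding dunkl_G_def by simp
  have F: "2 * x * dunkl_F \<rho>1 \<rho>2 x = (x - \<rho>1) * (x - \<rho>2)"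
    using assms(2) unfolding dunkl_F_def by (cases "x = 0") (auto simp: field_simps)
  show ?thesis
    unfolding dunkl_shift_def G [symmetric] F [symmetric] by (simp add: algebra_simps)
qed

lemma poly_L_monom:
  assumes "x \<noteq> -1/2" "x \<noteq> 0 \<or> \<rho>1 * \<rho>2 = 0"
  shows "poly (L_monom n) x = shift (\<lambda>y. y ^ n) x"
proof (induction n)
  case 0
  then show ?case by (simp add: dunkl_shift_def)
next
  case (Suc n)
  then show ?case
    using shift_times_x [OF assms, of "\<lambda>y. y ^ n"] by (simp add: poly_commutator poly_monom)
qed

lemma poly_L:
  assumes "x \<noteq> -1/2" "x \<noteq> 0 \<or> \<rho>1 * \<rho>2 = 0"
  shows "poly (L p) x = shift (poly p) x"
proof -
  have "shift (poly p) x = (\<Sum>i\<le>degree p. coeff p i * shift (\<lambda>y. y ^ i) x)"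
    unfolding dunkl_shift_def poly_altdef
    by (simp add: sum_distrib_left sum.distrib sum_subtractf algebra_simps)
  then show ?thesis
    by (simp add: L_def poly_sum poly_L_monom [OF assms])
qed

lemma L_eqI:
  assumes "\<And>x. x \<noteq> 0 \<Longrightarrow> x \<noteq> -1/2 \<Longrightarrow> shift (poly p) x = poly q x"
  shows "L p = q"
  by (rule poly_eq_off_finite [of "{0, -1/2}"]) (use assms in \<open>auto simp: poly_L\<close>)

lemma L_add: "L (p + q) = L p + L q"
  by (rule L_eqI) (simp add: poly_L dunkl_shift_def algebra_simps)

lemma L_smult: "L (smult c p) = smult c (L p)"
  by (rule L_eqI) (simp add: poly_L dunkl_shift_def algebra_simps)

lemma L_diff: "L (p - q) = L p - L q"
  by (rule L_eqI) (simp add: poly_L dunkl_shift_def algebra_simps)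

lemma L_times_x: "L ([:0, 1:] * p) = [:0, 1:] * L p + commutator p"
proof (rule L_eqI)
  fix x :: real assume "x \<noteq> 0" "x \<noteq> -1/2"
  then show "shift (poly ([:0, 1:] * p)) x = poly ([:0, 1:] * L p + commutator p) x"
    using shift_times_x [of x "poly p"] by (simp add: poly_L poly_commutator dunkl_shift_def)
qed

lemma is_bannai_ito_iff:
  "is_bannai_ito r1 r2 \<rho>1 \<rho>2 n p \<longleftrightarrow> degree p = n \<and> lead_coeff p = 1 \<and> L p = smult (ev n) p"
proof -
  have "L p = smult (ev n) p \<longleftrightarrow> (\<forall>x. x \<noteq> 0 \<longrightarrow> x \<noteq> -1/2 \<longrightarrow> shift (poly p) x = ev n * poly p x)"
    by (metis L_eqI poly_L poly_smult)
  then show ?thesis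
    by (simp add: is_bannai_ito_def)
qed

text \<open>
  The numerator of G is x^2 - \<open>G_sum\<close> x + \<open>G_prod\<close>; \<open>FG_gap\<close> is the difference of the constant terms of
  the numerators of F and G.
\<close>

definition G_prod :: real where
  "G_prod = (r1 - 1/2) * (r2 - 1/2)"

definition G_sum :: real where
  "G_sum = r1 + r2 - 1"

definition FG_gap :: real where
  "FG_gap = \<rho>1 * \<rho>2 - G_prod"

text \<open>
  A relation of the Bannai-Ito algebra, evaluated on an eigenspace.  Evaluating the left-hand side at x
  involves f at the five points x, -x, -x-1, x-1 and x+1.  The eigenvalue equations at -x and -x-1
  eliminate f(x-1) and f(x+1), the one at x eliminates f(-x-1), and the coefficients of f(x) and
  f(-x) in what remains vanish identically.
\<close>

lemma L_commutator:
  assumes "L f = smult l f"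
  shows "L (commutator f) = smult (g * FG_gap + l * (2 * FG_gap - \<rho>1 - \<rho>2) - l\<^sup>2) f
     - smult (3 * l + 2 * g + 1) (commutator f) - smult ((2 * l + g) * (2 * l + g + 1)) ([:0, 1:] * f)"
proof (rule poly_eq_off_finite [of "{0, -1/2, 1/2, -1}"])
  fix x :: real assume x: "x \<notin> {0, -1/2, 1/2, -1}"
  have nz: "x \<noteq> 0" "2 * x + 1 \<noteq> 0" "2 * x - 1 \<noteq> 0" "x + 1 \<noteq> 0"
    using x by auto
  have S: "shift (poly f) y = l * poly f y" if "y \<noteq> 0" "y \<noteq> -1/2" for y
    using poly_L [of y f] that assms(1) by simp
  define F0 G0 where "F0 = dunkl_F \<rho>1 \<rho>2 x" and "G0 = dunkl_G r1 r2 x"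
  define F1 G1 where "F1 = dunkl_F \<rho>1 \<rho>2 (-x)" and "G1 = dunkl_G r1 r2 (-x)"
  define F2 G2 where "F2 = dunkl_F \<rho>1 \<rho>2 (-x-1)" and "G2 = dunkl_G r1 r2 (-x-1)"
  define f0 f1 f2 f3 f4 where "f0 = poly f x" and "f1 = poly f (-x)" and "f2 = poly f (-x-1)"
    and "f3 = poly f (x-1)" and "f4 = poly f (x+1)"
  have e0: "F0 * (f0 - f1) + G0 * (f2 - f0) = l * f0"
    using S [of x] x by (simp add: dunkl_shift_def F0_def G0_def f0_def f1_def f2_def)
  have e1: "F1 * (f1 - f0) + G1 * (f3 - f1) = l * f1"
    using S [of "-x"] x by (simp add: dunkl_shift_def F1_def G1_def f0_def f1_def f3_def)
  have e2: "F2 * (f2 - f4) + G2 * (f0 - f2) = l * f2"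
    using S [of "-x-1"] x
    by (simp add: dunkl_shift_def F2_def G2_def f0_def f2_def f4_def add.commute)
  have d: "(x - \<rho>1) * (x - \<rho>2) = 2 * x * F0" "(x - r1 + 1/2) * (x - r2 + 1/2) = (2*x+1) * G0"
    "(-x - \<rho>1) * (-x - \<rho>2) = -2 * x * F1" "(-x - r1 + 1/2) * (-x - r2 + 1/2) = (1-2*x) * G1"
    "(-x-1 - \<rho>1) * (-x-1 - \<rho>2) = -2 * (x+1) * F2" "(-x-1 - r1 + 1/2) * (-x-1 - r2 + 1/2) = -(1+2*x) * G2"
    using nz by (simp_all add: F0_def G0_def F1_def G1_def F2_def G2_def dunkl_F_def dunkl_G_def)
  show "poly (L (commutator f)) x = poly (smult (g * FG_gap + l * (2 * FG_gap - \<rho>1 - \<rho>2) - l\<^sup>2) f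
     - smult (3 * l + 2 * g + 1) (commutator f) - smult ((2 * l + g) * (2 * l + g + 1)) ([:0, 1:] * f)) x"
  proof -
    define S0 where "S0 = 2 * x * F0 * f1 - (2 * x + 1) * G0 * f2"
    define S1 where "S1 = - 2 * x * F1 * f0 - (1 - 2 * x) * G1 * f3"
    define S2 where "S2 = - 2 * (x + 1) * F2 * f4 + (1 + 2 * x) * G2 * f0"
    have "poly (commutator f) x = S0"
      unfolding poly_commutator d S0_def f1_def f2_def by (simp add: mult.assoc)
    moreover have "poly (commutator f) (- x) = S1"
      unfolding poly_commutator d S1_def f0_def f3_def by simp
    moreover have "poly (commutator f) (- x - 1) = S2"
      unfolding poly_commutator d S2_def f0_def f4_def by (simp add: algebra_simps)
    ultimately have *: "poly (commutator f) x = S0" "poly (L (commutator f)) x = F0 * (S0 - S1) + G0 * (S2 - S0)"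
      using x by (simp_all add: poly_L dunkl_shift_def F0_def G0_def)
    define K where "K = g * FG_gap + l * (2 * FG_gap - \<rho>1 - \<rho>2) - l\<^sup>2"
    define c where "c = (2 * l + g) * (2 * l + g + 1)"
    define E where "E = l + G0 - F0"
    have G0f2: "G0 * f2 = E * f0 + F0 * f1"
      using e0 by (simp add: E_def algebra_simps)
    have G1f3: "G1 * f3 = (l - F1 + G1) * f1 + F1 * f0"
      using e1 by (simp add: algebra_simps)
    have F2f4: "F2 * f4 = (F2 - G2 - l) * f2 + G2 * f0"
      using e2 by (simp add: algebra_simps)
    have S0: "S0 = - (2 * x + 1) * E * f0 - F0 * f1"
      unfolding S0_def by (simp add: mult.assoc G0f2) (simp add: algebra_simps)
    have S1: "S1 = - F1 * f0 - (1 - 2 * x) * (l - F1 + G1) * f1"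
      unfolding S1_def by (simp add: mult.assoc G1f3) (simp add: algebra_simps)
    have G0S2: "G0 * S2 = (- 2 * (x + 1) * (F2 - G2 - l) * E - G0 * G2) * f0
        - 2 * (x + 1) * (F2 - G2 - l) * F0 * f1"
    proof -
      have "G0 * S2 = - 2 * (x + 1) * (F2 - G2 - l) * (G0 * f2) - G0 * G2 * f0"
        unfolding S2_def by (simp add: mult.assoc F2f4) (simp add: algebra_simps)
      then show ?thesis
        by (simp add: G0f2 algebra_simps)
    qed
    \<comment> \<open>The coefficient of f(x).\<close>
    have a: "- (F0 - G0 + 3 * l + 2 * g + 1) * (2 * x + 1) * E + F0 * F1
        - 2 * (x + 1) * (F2 - G2 - l) * E - G0 * G2 - K + c * x = 0"
      using nz
      by (simp add: E_def F0_def G0_def F1_def F2_def G2_def K_def c_def dunkl_F_def dunkl_G_def g_def FG_gap_def G_prod_def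
           divide_simps) algebra
    \<comment> \<open>The coefficient of f(-x).\<close>
    have b: "- (F0 - G0 + 3 * l + 2 * g + 1) * F0 + F0 * (1 - 2 * x) * (l - F1 + G1)
        - 2 * (x + 1) * (F2 - G2 - l) * F0 = 0"
    proof -
      have "- (F0 - G0 + 3 * l + 2 * g + 1) + (1 - 2 * x) * (l - F1 + G1) - 2 * (x + 1) * (F2 - G2 - l) = 0"
        using nz
        by (simp add: F0_def G0_def F1_def G1_def F2_def G2_def dunkl_F_def dunkl_G_def g_def
             divide_simps) algebra
      then show ?thesis
        by algebra
    qed
    have "F0 * (S0 - S1) + G0 * (S2 - S0) + (3 * l + 2 * g + 1) * S0 + c * x * f0 - K * f0
      = (- (F0 - G0 + 3 * l + 2 * g + 1) * (2 * x + 1) * E + F0 * F1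
        - 2 * (x + 1) * (F2 - G2 - l) * E - G0 * G2 - K + c * x) * f0
      + (- (F0 - G0 + 3 * l + 2 * g + 1) * F0 + F0 * (1 - 2 * x) * (l - F1 + G1)
        - 2 * (x + 1) * (F2 - G2 - l) * F0) * f1"
      using G0S2 S0 S1 by algebra
    then have "F0 * (S0 - S1) + G0 * (S2 - S0) = K * f0 - (3 * l + 2 * g + 1) * S0 - c * (x * f0)"
      unfolding a b by (simp add: algebra_simps)
    then show ?thesis
      by (simp add: * K_def c_def f0_def)
  qed
qed simp

end

section \<open>Leading coefficients\<close>

text \<open>
  Coefficients counted from the formal degree n downwards, and 0 beyond the constant term.  With this
  convention the shift rules below hold without case distinctions for small n.
\<close>

definition top_coeff :: "nat \<Rightarrow> nat \<Rightarrow> real poly \<Rightarrow> real" where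
  "top_coeff n j p = (if j \<le> n then coeff p (n - j) else 0)"

lemma top_coeff_0 [simp]: "top_coeff n 0 p = coeff p n"
  by (simp add: top_coeff_def)

lemma top_coeff_Suc_Suc [simp]: "top_coeff (Suc n) (Suc j) p = top_coeff n j p"
  by (simp add: top_coeff_def)

lemma top_coeff_0_Suc [simp]: "top_coeff 0 (Suc j) p = 0"
  by (simp add: top_coeff_def)

lemma top_coeff_linear [simp]:
  "top_coeff n j (p + q) = top_coeff n j p + top_coeff n j q"
  "top_coeff n j (p - q) = top_coeff n j p - top_coeff n j q"
  "top_coeff n j (smult c p) = c * top_coeff n j p"
  by (simp_all add: top_coeff_def)

lemma top_coeff_pCons_0: "top_coeff (Suc n) j (pCons 0 p) = top_coeff n j p"
  by (cases "j \<le> n") (auto simp: top_coeff_def Suc_diff_le not_le le_Suc_eq)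

lemma top_coeff_quadratic:
  "coeff ([:a, b, 1:] * p) (Suc n) = a * coeff p (Suc n) + b * coeff p n + top_coeff n 1 p"
  "top_coeff (Suc n) (Suc j) ([:a, b, 1:] * p)
     = a * top_coeff n j p + b * top_coeff n (Suc j) p + top_coeff n (Suc (Suc j)) p"
proof -
  have *: "[:a, b, 1:] * p = smult a p + smult b (pCons 0 p) + pCons 0 (pCons 0 p)"
    by (simp add: smult_add_right)
  have **: "top_coeff (Suc n) k (pCons 0 (pCons 0 p)) = top_coeff n (Suc k) p" for k
    by (metis top_coeff_Suc_Suc top_coeff_pCons_0)
  show "coeff ([:a, b, 1:] * p) (Suc n) = a * coeff p (Suc n) + b * coeff p n + top_coeff n 1 p"
    using **[of 0] by (simp add: *)
  show "top_coeff (Suc n) (Suc j) ([:a, b, 1:] * p)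
     = a * top_coeff n j p + b * top_coeff n (Suc j) p + top_coeff n (Suc (Suc j)) p"
    unfolding * top_coeff_linear ** top_coeff_pCons_0 [of n "Suc j" p] by simp
qed

lemma top_coeff_x_plus_1_power:
  "coeff ([:1, 1:] ^ n) n = (1 :: real) \<and>
   top_coeff n (Suc 0) ([:1, 1:] ^ n) = real n \<and>
   top_coeff n (Suc (Suc 0)) ([:1, 1:] ^ n) = real n * (real n - 1) / 2 \<and>
   top_coeff n (Suc (Suc (Suc 0))) ([:1, 1:] ^ n) = real n * (real n - 1) * (real n - 2) / 6"
proof (induction n)
  case (Suc n)
  have *: "[:1, 1:] ^ Suc n = [:1, 1:] ^ n + pCons 0 ([:1, 1:] ^ n :: real poly)"
    by simp
  have "coeff ([:1, 1:] ^ n) (Suc n) = (0::real)"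
    by (rule coeff_eq_0) (simp add: degree_linear_power)
  then show ?case
    using Suc unfolding * by (simp add: top_coeff_pCons_0 field_simps)
qed simp

context dunkl
begin

text \<open>
  The increments of the second subdiagonal of L up to sign; see \<open>top_coeff_commutator_monom\<close>.
\<close>

definition subdiag_step :: "real \<Rightarrow> real" where
  "subdiag_step y = y * (y - 1) * (y - 2) / 6 - G_sum * (y * (y - 1) / 2) + G_prod * y"

text \<open>
  Closed forms, by summation of the increments in \<open>top_coeff_commutator_monom\<close>, of the entries of L
  one and two places below the diagonal.  The increments alternate in sign, whence the dependence on
  the parity of n.
\<close>

definition subdiag1 :: "nat \<Rightarrow> real" where
  "subdiag1 n = (if even n then real n / 2 * (real n / 2 - 1 - G_sum)
     else FG_gap + G_sum * ((real n - 1) / 2) - ((real n - 1) / 2)\<^sup>2)"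

definition subdiag2 :: "nat \<Rightarrow> real" where
  "subdiag2 n = (let m = (if even n then real n / 2 else (real n - 1) / 2) in
     m * (m - 1) * ((4 * m - 5) / 6 - G_sum) + G_prod * m - (if even n then 0 else subdiag_step (real n - 1)))"

lemma commutator_monom:
  "commutator (monom 1 n) = smult ((-1) ^ n) ([:\<rho>1 * \<rho>2, - (\<rho>1 + \<rho>2), 1:] * monom 1 n
     - [:G_prod, - G_sum, 1:] * [:1, 1:] ^ n)"
proof -
  have "pcompose (monom 1 n) [:0, -1:] = smult ((-1) ^ n) (monom 1 n :: real poly)"
  proof (rule poly_ext)
    fix x :: real
    show "poly (pcompose (monom 1 n) [:0, -1:]) x = poly (smult ((-1) ^ n) (monom 1 n)) x"
      by (simp add: poly_pcompose poly_monom power_minus [of x])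
  qed
  moreover have "pcompose (monom 1 n) [:-1, -1:] = smult ((-1) ^ n) ([:1, 1:] ^ n :: real poly)"
  proof (rule poly_ext)
    fix x :: real
    have "(-1 - x) ^ n = (-1) ^ n * (1 + x) ^ n"
      using power_minus [of "1 + x" n] by simp
    then show "poly (pcompose (monom 1 n) [:-1, -1:]) x = poly (smult ((-1) ^ n) ([:1, 1:] ^ n)) x"
      by (simp add: poly_pcompose poly_monom)
  qed
  ultimately show ?thesis
    by (simp add: commutator_def G_prod_def G_sum_def smult_diff_right diff_diff_eq)
qed

lemma coeff_commutator_monom_eq_0:
  assumes "k > n + 1"
  shows "coeff (commutator (monom 1 n)) k = 0"
proof -
  obtain j where j: "k = Suc (Suc (n + j))"
    using assms by (metis add_Suc add_Suc_right less_iff_Suc_add add.right_neutral One_nat_def)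
  have "coeff ([:1, 1:] ^ n) i = (0::real)" if "i > n" for i
    using that by (intro coeff_eq_0) (simp add: degree_linear_power)
  then show ?thesis
    using top_coeff_x_plus_1_power [of n]
    by (cases j) (simp_all add: j commutator_monom)
qed

lemma top_coeff_monom:
  "top_coeff n j (monom 1 n) = (if j = 0 then 1 else 0)"
  by (auto simp: top_coeff_def)

lemma top_coeff_commutator_monom:
  "coeff (commutator (monom 1 n)) (Suc n) = (-1) ^ n * (- g - 1 - real n)"
  "top_coeff (Suc n) (Suc 0) (commutator (monom 1 n)) = (-1) ^ n * (FG_gap + G_sum * real n - real n * (real n - 1) / 2)"
  "top_coeff (Suc n) (Suc (Suc 0)) (commutator (monom 1 n)) = - ((-1) ^ n * subdiag_step (real n))"
proof -
  have *: "coeff ([:1, 1:] ^ n) (Suc n) = (0::real)"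
    by (intro coeff_eq_0) (simp add: degree_linear_power)
  show "coeff (commutator (monom 1 n)) (Suc n) = (-1) ^ n * (- g - 1 - real n)"
    "top_coeff (Suc n) (Suc 0) (commutator (monom 1 n)) = (-1) ^ n * (FG_gap + G_sum * real n - real n * (real n - 1) / 2)"
    "top_coeff (Suc n) (Suc (Suc 0)) (commutator (monom 1 n)) = - ((-1) ^ n * subdiag_step (real n))"
    unfolding commutator_monom coeff_smult coeff_diff top_coeff_linear top_coeff_quadratic
    by (simp_all add: top_coeff_monom * top_coeff_x_plus_1_power)
      (simp_all add: g_def G_sum_def FG_gap_def subdiag_step_def algebra_simps)
qed

lemma coeff_L_monom_eq_0: "coeff (L_monom n) k = 0" if "k > n"
  using that
proof (induction n arbitrary: k)
  case (Suc n)
  then obtain j where "k = Suc j" "j > n"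
    by (metis Suc_lessE)
  with Suc show ?case
    by (simp add: coeff_commutator_monom_eq_0)
qed simp

lemma top_coeff_L_monom:
  "coeff (L_monom n) n = ev n \<and> top_coeff n (Suc 0) (L_monom n) = subdiag1 n \<and>
   top_coeff n (Suc (Suc 0)) (L_monom n) = subdiag2 n"
proof (induction n)
  case 0
  then show ?case
    by (simp add: subdiag1_def subdiag2_def bi_eigenvalue_def)
next
  case (Suc n)
  have 1: "[:0, 1:] * L_monom n = pCons 0 (L_monom n)"
    by simp
  show ?case
  proof (cases "even n")
    case True
    then show ?thesis
      unfolding L_monom.simps 1 using Suc
      by (simp add: top_coeff_commutator_monom top_coeff_pCons_0 del: top_coeff_Suc_Suc)
        (simp add: subdiag1_def subdiag2_def bi_eigenvalue_def subdiag_step_def g_def FG_gap_def Let_def power2_eq_square field_simps)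
  next
    case False
    then show ?thesis
      unfolding L_monom.simps 1 using Suc
      by (simp add: top_coeff_commutator_monom top_coeff_pCons_0 del: top_coeff_Suc_Suc)
        (simp add: subdiag1_def subdiag2_def bi_eigenvalue_def subdiag_step_def g_def FG_gap_def Let_def power2_eq_square field_simps)
  qed
qed

lemma L_const: "L [:a:] = 0"
  by (rule L_eqI) (simp add: dunkl_shift_def)

lemma L_monom_eq: "L (monom 1 n) = L_monom n"
  by (rule L_eqI) (simp add: poly_L_monom poly_monom fun_eq_iff [of "poly (monom 1 n)"] dunkl_shift_def)

lemma split_lead_coeff:
  fixes p :: "real poly"
  assumes "degree p \<le> Suc n"
  obtains q where "p = smult (coeff p (Suc n)) (monom 1 (Suc n)) + q" "degree q \<le> n"
proof
  let ?q = "p - smult (coeff p (Suc n)) (monom 1 (Suc n))"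
  show "p = smult (coeff p (Suc n)) (monom 1 (Suc n)) + ?q"
    by simp
  show "degree ?q \<le> n"
    using assms by (intro degree_le allI impI) (auto simp: coeff_eq_0)
qed

lemma degree_L: "degree p \<le> n \<Longrightarrow> degree (L p) \<le> n"
  unfolding L_def
  by (intro degree_sum_le) (auto intro!: degree_le coeff_L_monom_eq_0 intro: order.trans [OF degree_smult_le])

lemma L_split_lead_coeff:
  assumes "degree p \<le> Suc n"
  obtains q where "degree q \<le> n" "\<And>k. k \<le> n \<Longrightarrow> coeff q k = coeff p k"
    "L p = smult (coeff p (Suc n)) (L_monom (Suc n)) + L q"
proof -
  obtain q where q: "p = smult (coeff p (Suc n)) (monom 1 (Suc n)) + q" "degree q \<le> n"
    using split_lead_coeff [OF assms] by blast
  show ?thesis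
  proof
    show "coeff q k = coeff p k" if "k \<le> n" for k
      using that by (subst q) simp
    show "L p = smult (coeff p (Suc n)) (L_monom (Suc n)) + L q"
      by (subst q) (simp add: L_add L_smult L_monom_eq del: L_monom.simps)
  qed (rule q)
qed

lemma coeff_L:
  assumes "degree p \<le> n"
  shows "coeff (L p) n = ev n * coeff p n"
proof (cases n)
  case 0
  with assms obtain a where "p = [:a:]"
    by (metis degree_eq_zeroE le_zero_eq)
  with 0 show ?thesis
    by (simp add: L_const bi_eigenvalue_def)
next
  case (Suc m)
  then obtain q where q: "degree q \<le> m" "L p = smult (coeff p (Suc m)) (L_monom (Suc m)) + L q"
    using L_split_lead_coeff assms by metis
  have "coeff (L q) (Suc m) = 0"
    using degree_L [OF q(1)] by (simp add: coeff_eq_0)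
  then show ?thesis
    using top_coeff_L_monom [of "Suc m"] by (simp add: q(2) Suc del: L_monom.simps)
qed

lemma coeff_L_1:
  assumes "degree p \<le> Suc m"
  shows "coeff (L p) m = subdiag1 (Suc m) * coeff p (Suc m) + ev m * coeff p m"
proof -
  obtain q where q: "degree q \<le> m" "\<And>k. k \<le> m \<Longrightarrow> coeff q k = coeff p k"
      "L p = smult (coeff p (Suc m)) (L_monom (Suc m)) + L q"
    using L_split_lead_coeff assms by metis
  then show ?thesis
    using top_coeff_L_monom [of "Suc m"] by (simp add: coeff_L del: L_monom.simps)
qed

lemma coeff_L_2:
  assumes "degree p \<le> Suc (Suc m)"
  shows "coeff (L p) m = subdiag2 (Suc (Suc m)) * coeff p (Suc (Suc m))
    + subdiag1 (Suc m) * coeff p (Suc m) + ev m * coeff p m"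
proof -
  obtain q where q: "degree q \<le> Suc m" "\<And>k. k \<le> Suc m \<Longrightarrow> coeff q k = coeff p k"
      "L p = smult (coeff p (Suc (Suc m))) (L_monom (Suc (Suc m))) + L q"
    using L_split_lead_coeff assms by metis
  then show ?thesis
    using top_coeff_L_monom [of "Suc (Suc m)"] by (simp add: coeff_L_1 del: L_monom.simps)
qed

end

section \<open>Eigenpolynomials\<close>

locale dunkl_simple = dunkl +
  assumes inj_ev: "inj (bi_eigenvalue r1 r2 \<rho>1 \<rho>2)"
begin

lemma ev_eq_iff: "ev m = ev n \<longleftrightarrow> m = n"
  using inj_ev by (auto simp: inj_eq)

lemma degree_eigenvector:
  assumes "L q = smult (ev m) q" "q \<noteq> 0"
  shows "degree q = m"
proof -
  have "ev (degree q) * lead_coeff q = ev m * lead_coeff q"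
    by (metis coeff_L assms(1) coeff_smult order_refl)
  then have "ev (degree q) = ev m"
    using assms(2) by (metis mult_right_cancel leading_coeff_0_iff)
  then show ?thesis
    by (simp add: ev_eq_iff)
qed

text \<open>
  Back substitution, from the highest coefficient downwards, for a triangular operator
  whose first n diagonal entries differ from c.
\<close>

lemma solve_below:
  assumes "\<And>k. k < n \<Longrightarrow> c \<noteq> ev k" "\<And>k. k \<ge> n \<Longrightarrow> coeff r k = 0"
  obtains q where "\<And>k. k \<ge> n \<Longrightarrow> coeff q k = 0" "L q - smult c q = r"
  using assms
proof (induction n arbitrary: r thesis)
  case 0
  then have "r = 0"
    by (simp add: poly_eq_iff)
  then show ?case
    using 0(1)[of 0] L_const [of 0] by simp
next
  case (Suc n)
  define p where "p = smult (coeff r n / (ev n - c)) (monom 1 n)"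
  have deg: "degree p \<le> n"
    by (simp add: p_def degree_monom_eq)
  have "coeff (r - (L p - smult c p)) k = 0" if "k \<ge> n" for k
  proof (cases "k = n")
    case True
    then show ?thesis
      using Suc(3)[of n] coeff_L [OF deg] by (simp add: p_def field_simps)
  next
    case False
    with that have "k > n" by simp
    then show ?thesis
      using Suc(4)[of k] degree_L [OF deg] deg by (simp add: coeff_eq_0)
  qed
  then obtain q where q: "\<And>k. k \<ge> n \<Longrightarrow> coeff q k = 0" "L q - smult c q = r - (L p - smult c p)"
    using Suc(1)[of "r - (L p - smult c p)"] Suc(3) by (metis less_SucI)
  show ?case
  proof (rule Suc(2))
    show "coeff (q + p) k = 0" if "k \<ge> Suc n" for k
      using that q(1)[of k] by (simp add: p_def)
    show "L (q + p) - smult c (q + p) = r"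
      using q(2) by (simp add: L_add smult_add_right algebra_simps)
  qed
qed

lemma ex1_bannai_ito: "\<exists>!p. is_bannai_ito r1 r2 \<rho>1 \<rho>2 n p"
proof -
  let ?m = "monom (1::real) n"
  have "coeff (smult (ev n) ?m - L ?m) k = 0" if "k \<ge> n" for k
  proof (cases "k = n")
    case True
    then show ?thesis
      using coeff_L [of ?m n] by (simp add: degree_monom_eq)
  next
    case False
    with that have "k > n" by simp
    then show ?thesis
      using degree_L [of ?m n] by (simp add: coeff_eq_0 degree_monom_eq)
  qed
  moreover have "ev n \<noteq> ev k" if "k < n" for k
    using that by (simp add: ev_eq_iff)
  ultimately obtain q where q: "\<And>k. k \<ge> n \<Longrightarrow> coeff q k = 0" "L q - smult (ev n) q = smult (ev n) ?m - L ?m"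
    using solve_below [of n "ev n" "smult (ev n) ?m - L ?m"] by metis
  have "coeff (?m + q) n = 1" "degree (?m + q) \<le> n"
    using q(1) by (auto intro: degree_le)
  moreover from this have "degree (?m + q) = n"
    by (metis le_antisym le_degree zero_neq_one)
  moreover have "L (?m + q) = smult (ev n) (?m + q)"
    using q(2) by (simp add: L_add smult_add_right algebra_simps)
  ultimately have ex: "is_bannai_ito r1 r2 \<rho>1 \<rho>2 n (?m + q)"
    by (simp add: is_bannai_ito_iff)
  have "p = ?m + q" if p: "is_bannai_ito r1 r2 \<rho>1 \<rho>2 n p" for p
  proof (rule ccontr)
    assume "p \<noteq> ?m + q"
    then have nz: "p - (?m + q) \<noteq> 0" by simp
    have "L (p - (?m + q)) = smult (ev n) (p - (?m + q))"
      using p \<open>L (?m + q) = _\<close> by (simp add: is_bannai_ito_iff L_diff smult_diff_right)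
    then have "degree (p - (?m + q)) = n"
      using nz by (rule degree_eigenvector)
    moreover have "coeff (p - (?m + q)) n = 0"
      using p \<open>coeff (?m + q) n = 1\<close> by (auto simp: is_bannai_ito_iff)
    ultimately show False
      using nz by (metis leading_coeff_0_iff)
  qed
  with ex show ?thesis
    by blast
qed

abbreviation P :: "nat \<Rightarrow> real poly" where
  "P \<equiv> bannai_ito r1 r2 \<rho>1 \<rho>2"

lemma is_bannai_ito_P: "is_bannai_ito r1 r2 \<rho>1 \<rho>2 n (P n)"
  unfolding bannai_ito_def by (rule theI' [OF ex1_bannai_ito])

lemma degree_P [simp]: "degree (P n) = n"
  and coeff_P [simp]: "coeff (P n) n = 1"
  and L_P: "L (P n) = smult (ev n) (P n)"
  using is_bannai_ito_P [of n] by (auto simp: is_bannai_ito_iff)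

lemma eigenvector_eq:
  assumes "L q = smult (ev m) q"
  shows "q = smult (coeff q m) (P m)"
proof (rule ccontr)
  assume "q \<noteq> smult (coeff q m) (P m)"
  then have nz: "q - smult (coeff q m) (P m) \<noteq> 0" by simp
  have "L (q - smult (coeff q m) (P m)) = smult (ev m) (q - smult (coeff q m) (P m))"
    by (simp add: L_diff L_smult L_P assms smult_diff_right mult.commute)
  then have "degree (q - smult (coeff q m) (P m)) = m"
    using nz by (rule degree_eigenvector)
  then show False
    using nz coeff_P [of m] leading_coeff_0_iff [of "q - smult (coeff q m) (P m)"] by simp
qed

section \<open>The recurrence\<close>

text \<open>
  With l = \<lambda>(n+1), lp = \<lambda>(n+2) and lm = \<lambda>(n), the sum lp + lm and the product
  (l - lp)(l - lm) are polynomials in l that do not depend on the parity of n.  They are the coefficients in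
  \<open>L_commutator\<close>, so (L - lp)(L - lm) maps x P(n+1) to a multiple of P(n+1).  Subtracting a multiple
  of P(n+1) leaves a polynomial killed by this product; its part in the kernel of
  L - lp is P(n+2) and its part in the kernel of L - lm is a multiple of P(n).
\<close>

lemma three_terms:
  "\<exists>b v. [:0, 1:] * P (Suc n) = P (Suc (Suc n)) + smult b (P (Suc n)) + smult v (P n)"
proof -
  define l lp lm where "l = ev (Suc n)" and "lp = ev (Suc (Suc n))" and "lm = ev n"
  define \<kappa> where "\<kappa> = g * FG_gap + l * (2 * FG_gap - \<rho>1 - \<rho>2) - l\<^sup>2"
  define C where "C = commutator (P (Suc n))"
  define R where "R = [:0, 1:] * P (Suc n)"
  have ne: "l \<noteq> lp" "l \<noteq> lm" "lp \<noteq> lm"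
    by (simp_all add: l_def lp_def lm_def ev_eq_iff)
  define b where "b = \<kappa> / ((l - lp) * (l - lm))"
  have b: "b * ((l - lp) * (l - lm)) = \<kappa>"
    using ne by (simp add: b_def)
  have sum: "lp + lm = - 2 * l - 2 * g - 1"
    by (auto simp: l_def lp_def lm_def bi_eigenvalue_def g_def field_simps)
  have prod: "(l - lp) * (l - lm) = (2 * l + g) * (2 * l + g + 1)"
    by (auto simp: l_def lp_def lm_def bi_eigenvalue_def g_def field_simps)
  define R' where "R' = R - smult b (P (Suc n))"
  define V where "V = L R' - smult lm R'"
  have LP: "L (P (Suc n)) = smult l (P (Suc n))"
    by (simp add: L_P l_def)
  have LR: "L R = smult l R + C"
    unfolding R_def L_times_x LP C_def by simp
  have LC: "L C = smult \<kappa> (P (Suc n)) - smult (3 * l + 2 * g + 1) C - smult ((2 * l + g) * (2 * l + g + 1)) R"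
    unfolding C_def R_def \<kappa>_def by (rule L_commutator [OF LP])
  have V: "V = smult (l - lm) R + C - smult (b * (l - lm)) (P (Suc n))"
    by (rule poly_ext) (simp add: V_def R'_def L_diff L_smult LR LP algebra_simps)
  have "L V = smult lp V"
  proof (rule poly_ext)
    fix x
    have "poly (L V) x = (l - lm) * (l * poly R x + poly C x)
      + (\<kappa> * poly (P (Suc n)) x - (3 * l + 2 * g + 1) * poly C x - (2 * l + g) * (2 * l + g + 1) * poly R x)
      - b * (l - lm) * (l * poly (P (Suc n)) x)"
      unfolding V by (simp add: L_diff L_add L_smult LR LP LC)
    also have "\<dots> = lp * ((l - lm) * poly R x + poly C x - b * (l - lm) * poly (P (Suc n)) x)"
      using sum prod b by algebra
    finally show "poly (L V) x = poly (smult lp V) x"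
      by (simp add: V)
  qed
  then have V1: "V = smult (coeff V (Suc (Suc n))) (P (Suc (Suc n)))"
    unfolding lp_def by (rule eigenvector_eq)
  have deg: "degree R' \<le> Suc (Suc n)"
    unfolding R'_def R_def
    by (intro degree_diff_le order.trans [OF degree_mult_le] order.trans [OF degree_smult_le]) simp_all
  have R'1: "coeff R' (Suc (Suc n)) = 1"
    by (simp add: R'_def R_def coeff_eq_0)
  have "coeff V (Suc (Suc n)) = lp - lm"
    using coeff_L [OF deg] by (simp add: V_def R'1 lp_def)
  with V1 have V2: "L R' - smult lm R' = smult (lp - lm) (P (Suc (Suc n)))"
    by (simp add: V_def)
  define Z where "Z = R' - P (Suc (Suc n))"
  have "L Z = smult (ev n) Z"
  proof (rule poly_ext)
    fix x
    have "poly (L R') x - lm * poly R' x = (lp - lm) * poly (P (Suc (Suc n))) x"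
      using arg_cong [OF V2, of "\<lambda>p. poly p x"] by simp
    then show "poly (L Z) x = poly (smult (ev n) Z) x"
      by (simp add: Z_def L_diff L_P lp_def [symmetric] lm_def [symmetric] algebra_simps)
  qed
  then have "Z = smult (coeff Z n) (P n)"
    by (rule eigenvector_eq)
  moreover have "R = P (Suc (Suc n)) + smult b (P (Suc n)) + Z"
    by (simp add: Z_def R'_def)
  ultimately have "[:0, 1:] * P (Suc n) = P (Suc (Suc n)) + smult b (P (Suc n)) + smult (coeff Z n) (P n)"
    unfolding R_def by metis
  then show ?thesis by blast
qed

lemma P_0: "P 0 = 1"
  by (metis coeff_P degree_P degree_eq_zeroE lead_coeff_pCons(2) one_pCons coeff_pCons_0)

lemma ev_diff_1: "ev (Suc n) - ev n = (if even n then - 1 else 1) * (real (Suc n) + g)"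
  by (simp add: bi_eigenvalue_def g_def field_simps)

lemma Suc_plus_g_neq_0: "real (Suc n) + g \<noteq> 0"
proof
  assume "real (Suc n) + g = 0"
  then have "ev (Suc n) - ev n = 0"
    unfolding ev_diff_1 by simp
  then show False
    using ev_eq_iff [of "Suc n" n] by simp
qed

lemma eigen_coeff_1:
  "(ev (Suc n) - ev n) * coeff (P (Suc n)) n = subdiag1 (Suc n)"
  using coeff_L_1 [of "P (Suc n)" n] by (simp add: L_P algebra_simps)

lemma eigen_coeff_2:
  "(ev (Suc (Suc n)) - ev n) * coeff (P (Suc (Suc n))) n
     = subdiag2 (Suc (Suc n)) + subdiag1 (Suc n) * coeff (P (Suc (Suc n))) (Suc n)"
  using coeff_L_2 [of "P (Suc (Suc n))" n] by (simp add: L_P algebra_simps)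

lemma ev_diff_2: "ev (Suc (Suc n)) - ev n = (if even n then 1 else -1)"
  by (simp add: bi_eigenvalue_def field_simps)

definition second_coeff :: "nat \<Rightarrow> real" where
  "second_coeff n = top_coeff n (Suc (Suc 0)) (P n)"

text \<open>
  For n = 0 there is no such coefficient; then both sides vanish because the second subdiagonal
  entry of L x and the first one of L 1 do.
\<close>

lemma second_coeff_Suc:
  "second_coeff (Suc n) = (if even n then -1 else 1) * (subdiag2 (Suc n) + subdiag1 n * coeff (P (Suc n)) n)"
proof (cases n)
  case 0
  then show ?thesis
    by (simp add: second_coeff_def subdiag1_def subdiag2_def subdiag_step_def Let_def)
next
  case (Suc m)
  then show ?thesis
    using eigen_coeff_2 [of m] ev_diff_2 [of m]
    by (auto simp: second_coeff_def split: if_splits)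
qed

text \<open>
  Here a is the subleading coefficient of P(n+1).  The assumed form of u is what comparison of leading
  coefficients in the recurrence gives once the eigenvalue equation has eliminated the subleading
  coefficient of P(n+2).  It remains to factorize it.  For odd index the four factors come from the resultant of
  y^2 - (\<rho>1 + \<rho>2) y + \<rho>1 \<rho>2 and y^2 + (a1 + a2) y + a1 a2, which equals the product of all
  \<rho>i + aj; for even index, B = - A and two factors can be split off at once.
\<close>

lemma eq_bi_uI:
  assumes a: "(if even n then - 1 else 1) * (real (Suc n) + g) * a = subdiag1 (Suc n)"
    and u: "u = (if even n then -1 else 1) * (subdiag2 (Suc n) + subdiag2 (Suc (Suc n)) + a * (subdiag1 n - subdiag1 (Suc (Suc n)))) - a\<^sup>2"
  shows "u = bi_u r1 r2 \<rho>1 \<rho>2 (Suc n)"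
proof -
  define w where "w = real (Suc n) + g"
  have w: "w \<noteq> 0"
    using Suc_plus_g_neq_0 [of n] by (simp add: w_def)
  define A where "A = subdiag1 (Suc n)"
  define B where "B = subdiag2 (Suc n) + subdiag2 (Suc (Suc n))"
  define D where "D = subdiag1 n - subdiag1 (Suc (Suc n))"
  have eqI: "u = X / (16 * w\<^sup>2)" if "16 * w\<^sup>2 * u = X" for X
    using that w by (simp add: field_simps)
  show ?thesis
  proof (cases "even n")
    case True
    then have wa: "w * a = - A"
      using a by (simp add: w_def A_def algebra_simps)
    have "16 * w\<^sup>2 * u = - 16 * w\<^sup>2 * B - 16 * w * (w * a) * D - 16 * (w * a)\<^sup>2"
      unfolding u using True by (simp add: B_def D_def power2_eq_square algebra_simps)
    also have "\<dots> = - 16 * (w\<^sup>2 * B - w * A * D + A\<^sup>2)"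
      unfolding wa by (simp add: algebra_simps)
    finally have wu: "16 * w\<^sup>2 * u = - 16 * (w\<^sup>2 * B - w * A * D + A\<^sup>2)" .
    obtain m where m: "n = 2 * m"
      using True by (auto elim!: evenE)
    define a1 a2 where "a1 = real m + 1/2 - r1" and "a2 = real m + 1/2 - r2"
    have "B = a1 * a2"
      by (simp add: B_def m subdiag2_def subdiag_step_def G_prod_def G_sum_def a1_def a2_def Let_def field_simps)
    moreover have "A = \<rho>1 * \<rho>2 - a1 * a2"
      by (simp add: A_def m subdiag1_def FG_gap_def G_prod_def G_sum_def a1_def a2_def power2_eq_square field_simps)
    moreover have "D = - (a1 + a2)"
      by (simp add: D_def m subdiag1_def G_sum_def a1_def a2_def field_simps)
    moreover have "w = \<rho>1 + \<rho>2 + a1 + a2"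
      by (simp add: w_def g_def m a1_def a2_def)
    ultimately have e: "w\<^sup>2 * B - w * A * D + A\<^sup>2 = (\<rho>1 + a1) * (\<rho>1 + a2) * (\<rho>2 + a1) * (\<rho>2 + a2)"
      by algebra
    have f: "real (Suc n) + 2 * \<rho>1 - 2 * r1 = 2 * (\<rho>1 + a1)" "real (Suc n) + 2 * \<rho>1 - 2 * r2 = 2 * (\<rho>1 + a2)"
      "real (Suc n) + 2 * \<rho>2 - 2 * r1 = 2 * (\<rho>2 + a1)" "real (Suc n) + 2 * \<rho>2 - 2 * r2 = 2 * (\<rho>2 + a2)"
      by (simp_all add: m a1_def a2_def)
    have "16 * w\<^sup>2 * u = - ((real (Suc n) + 2 * \<rho>1 - 2 * r1) * (real (Suc n) + 2 * \<rho>1 - 2 * r2)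
               * (real (Suc n) + 2 * \<rho>2 - 2 * r1) * (real (Suc n) + 2 * \<rho>2 - 2 * r2))"
      unfolding wu e f by algebra
    from eqI [OF this] show ?thesis
      using True by (simp add: bi_u_def w_def g_def Let_def)
  next
    case False
    then have wa: "w * a = A"
      using a by (simp add: w_def A_def algebra_simps)
    have "16 * w\<^sup>2 * u = 16 * w\<^sup>2 * B + 16 * w * (w * a) * D - 16 * (w * a)\<^sup>2"
      unfolding u using False by (simp add: B_def D_def power2_eq_square algebra_simps)
    also have "\<dots> = 16 * (w\<^sup>2 * B + w * A * D - A\<^sup>2)"
      unfolding wa by (simp add: algebra_simps)
    finally have wu: "16 * w\<^sup>2 * u = 16 * (w\<^sup>2 * B + w * A * D - A\<^sup>2)" .
    obtain m where m: "n = 2 * m + 1"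
      using False by (auto elim!: oddE)
    define k where "k = real m + 1"
    have n: "real (Suc n) = 2 * k"
      by (simp add: m k_def)
    have "A = k * (k - r1 - r2)"
    proof -
      have "A = k * (k - 1 - G_sum)"
        by (simp add: A_def m subdiag1_def k_def add_divide_distrib)
      then show ?thesis
        by (simp add: G_sum_def)
    qed
    moreover have "B = - k * (k - r1 - r2)"
      by (simp add: B_def m subdiag2_def subdiag_step_def G_prod_def G_sum_def k_def Let_def field_simps)
    moreover have "D = 2 * k - r1 - r2"
    proof -
      have "subdiag1 n = FG_gap + G_sum * real m - (real m)\<^sup>2"
        by (simp add: m subdiag1_def)
      moreover have "subdiag1 (Suc (Suc n)) = FG_gap + G_sum * (real m + 1) - (real m + 1)\<^sup>2"
        by (simp add: m subdiag1_def) (simp add: power2_eq_square field_simps)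
      ultimately show ?thesis
        by (simp add: D_def G_sum_def k_def power2_eq_square algebra_simps)
    qed
    moreover have "w = 2 * k + \<rho>1 + \<rho>2 - r1 - r2"
      unfolding w_def n by (simp add: g_def)
    ultimately have e: "16 * (w\<^sup>2 * B + w * A * D - A\<^sup>2)
        = - (2 * k * (2 * k + 2 * \<rho>1 + 2 * \<rho>2) * (2 * k - 2 * r1 - 2 * r2) * (2 * k + 2 * g))"
      unfolding g_def by algebra
    have "16 * w\<^sup>2 * u = - (real (Suc n) * (real (Suc n) + 2 * \<rho>1 + 2 * \<rho>2)
               * (real (Suc n) - 2 * r1 - 2 * r2) * (real (Suc n) + 2 * g))"
      unfolding n wu e ..
    from eqI [OF this] show ?thesis
      using False by (simp add: bi_u_def w_def g_def Let_def)
  qed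
qed

lemma recurrence:
  "\<exists>b. [:0, 1:] * P (Suc n)
     = P (Suc (Suc n)) + smult b (P (Suc n)) + smult (bi_u r1 r2 \<rho>1 \<rho>2 (Suc n)) (P n)"
proof -
  obtain b v where eq: "[:0, 1:] * P (Suc n) = P (Suc (Suc n)) + smult b (P (Suc n)) + smult v (P n)"
    using three_terms by blast
  define a0 a1 where "a0 = coeff (P (Suc n)) n" and "a1 = coeff (P (Suc (Suc n))) (Suc n)"
  have "a0 = a1 + b"
    using arg_cong [OF eq, of "\<lambda>p. coeff p (Suc n)"] by (simp add: a0_def a1_def coeff_eq_0)
  moreover have "second_coeff (Suc n) = second_coeff (Suc (Suc n)) + b * a0 + v"
    using arg_cong [OF eq, of "top_coeff (Suc (Suc n)) (Suc (Suc 0))"]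
    by (simp add: second_coeff_def a0_def top_coeff_pCons_0 del: top_coeff_Suc_Suc)
     (simp add: top_coeff_pCons_0)
  ultimately have v: "v = second_coeff (Suc n) - second_coeff (Suc (Suc n)) - (a0 - a1) * a0"
    by simp
  have "v = bi_u r1 r2 \<rho>1 \<rho>2 (Suc n)"
  proof (rule eq_bi_uI)
    show a: "(if even n then - 1 else 1) * (real (Suc n) + g) * a0 = subdiag1 (Suc n)"
      using eigen_coeff_1 [of n] unfolding ev_diff_1 a0_def by simp
    have a': "(if even n then 1 else -1) * (real (Suc (Suc n)) + g) * a1 = subdiag1 (Suc (Suc n))"
      using eigen_coeff_1 [of "Suc n"] unfolding ev_diff_1 a1_def by (cases "even n") simp_all
    show "v = (if even n then -1 else 1) * (subdiag2 (Suc n) + subdiag2 (Suc (Suc n)) + a0 * (subdiag1 n - subdiag1 (Suc (Suc n)))) - a0\<^sup>2"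
      unfolding v second_coeff_Suc a [symmetric] a' [symmetric] a0_def [symmetric] a1_def [symmetric]
      by (auto simp: field_simps power2_eq_square)
  qed
  with eq show ?thesis by blast
qed

end

section \<open>Truncation to the grid\<close>

text \<open>
  Summation by parts: a tridiagonal difference operator in divergence form is symmetric, since the
  right-hand side is symmetric in f and g.
\<close>

lemma tridiagonal_sum:
  fixes c w f g Lf :: "nat \<Rightarrow> real"
  assumes "\<And>s. s \<le> N \<Longrightarrow> w s * Lf s = (if s < N then c s * (f (Suc s) - f s) else 0)
     + (if 0 < s then c (s - 1) * (f (s - 1) - f s) else 0)"
  shows "(\<Sum>s\<le>N. w s * Lf s * g s) = - (\<Sum>s<N. c s * (f (Suc s) - f s) * (g (Suc s) - g s))"
proof -
  have "(\<Sum>s\<le>N. w s * Lf s * g s)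
      = (\<Sum>s\<le>N. if s < N then c s * (f (Suc s) - f s) * g s else 0)
      + (\<Sum>s\<le>N. if 0 < s then c (s - 1) * (f (s - 1) - f s) * g s else 0)"
    unfolding sum.distrib [symmetric]
  proof (rule sum.cong)
    fix s assume "s \<in> {..N}"
    then have "s \<le> N" by simp
    then show "w s * Lf s * g s = (if s < N then c s * (f (Suc s) - f s) * g s else 0)
        + (if 0 < s then c (s - 1) * (f (s - 1) - f s) * g s else 0)"
      unfolding assms [OF \<open>s \<le> N\<close>] by (simp add: distrib_right)
  qed simp
  also have "(\<Sum>s\<le>N. if s < N then c s * (f (Suc s) - f s) * g s else 0)
      = (\<Sum>s<N. c s * (f (Suc s) - f s) * g s)"
    by (simp add: lessThan_Suc_atMost [symmetric])
  also have "(\<Sum>s\<le>N. if 0 < s then c (s - 1) * (f (s - 1) - f s) * g s else 0)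
      = (\<Sum>s<N. c s * (f s - f (Suc s)) * g (Suc s))"
    by (cases N) (simp_all add: sum.atMost_Suc_shift lessThan_Suc_atMost del: sum.atMost_Suc)
  finally show ?thesis
    by (simp add: sum.distrib [symmetric] sum_negf [symmetric] algebra_simps)
qed

locale dunkl_grid = dunkl +
  fixes N :: nat and e d :: real
  assumes even_N: "even N" and N_ge_2: "N \<ge> 2"
    and r1_pos: "r1 > 0" and e_pos: "e > 0" and d_pos: "d > 0"
    and r2_eq: "r2 = r1 + e + real N / 2"
    and \<rho>1_eq: "\<rho>1 = r1 + e + d + (real N - 1) / 2"
    and \<rho>2_eq: "\<rho>2 = r1 + e - 1/2"
begin

lemma g_eq: "g = e + d - 1"
  unfolding g_def by (simp add: r2_eq \<rho>1_eq \<rho>2_eq field_simps)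

lemma ev_neg: "odd n \<Longrightarrow> ev n < 0"
  using g_eq e_pos d_pos odd_pos [of n] unfolding g_def by (auto simp: bi_eigenvalue_def field_simps)

lemma ev_nonneg: "even n \<Longrightarrow> ev n \<ge> 0"
  by (auto simp: bi_eigenvalue_def)

sublocale dunkl_simple
proof
  show "inj ev"
  proof (rule injI)
    fix m n assume *: "ev m = ev n"
    then have "even m \<longleftrightarrow> even n"
      using ev_neg ev_nonneg by (metis linorder_not_le)
    with * show "m = n"
      by (auto simp: bi_eigenvalue_def split: if_splits)
  qed
qed

abbreviation x :: "nat \<Rightarrow> real" where
  "x \<equiv> bi_grid \<rho>2"

lemma x_even: "even s \<Longrightarrow> x s = r1 + e - 1/2 + real s / 2"
  by (simp add: bi_grid_def \<rho>2_eq)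

lemma x_odd: "odd s \<Longrightarrow> x s = - (r1 + e + real s / 2)"
  by (simp add: bi_grid_def \<rho>2_eq)

lemma x_Suc: "x (Suc s) = (if even s then - x s - 1 else - x s)"
  by (simp add: x_even x_odd field_simps)

lemma x_gt: "even s \<Longrightarrow> x s > -1/2" and x_lt: "odd s \<Longrightarrow> x s < -1/2"
  using r1_pos e_pos odd_pos [of s] by (auto simp: x_even x_odd)

lemma x_0: "x 0 = \<rho>2"
  by (simp add: bi_grid_def)

lemma inj_x: "inj x"
proof (rule injI)
  fix i j assume *: "x i = x j"
  then have "even i \<longleftrightarrow> even j"
    using x_gt x_lt by (metis order_less_asym)
  with * show "i = j"
    by (cases "even i") (simp_all add: x_even x_odd)
qed

lemma x_pred: "0 < s \<Longrightarrow> x (s - Suc 0) = (if even s then - x s else - x s - 1)"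
  using x_Suc [of "s - 1"] by (cases "even s") auto

lemma x_eq_uminus_\<rho>2:
  assumes "x s = - \<rho>2"
  shows "\<rho>2 = 0"
proof -
  have "even s"
    using assms x_odd [of s] odd_pos [of s] \<rho>2_eq by fastforce
  show ?thesis
  proof (cases "s = 0")
    case False
    with \<open>even s\<close> have "real s \<ge> 2"
      by (auto elim!: evenE)
    then show ?thesis
      using assms x_even [OF \<open>even s\<close>] \<rho>2_eq r1_pos e_pos by simp
  qed (use assms x_0 in simp)
qed

lemma x_eq_0:
  assumes "x s = 0"
  shows "\<rho>2 = 0"
proof -
  have "even s"
    using assms x_lt [of s] by auto
  show ?thesis
  proof (cases "s = 0")
    case False
    with \<open>even s\<close> have "real s \<ge> 2"
      by (auto elim!: evenE)
    then show ?thesis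
      using assms x_even [OF \<open>even s\<close>] r1_pos e_pos by simp
  qed (use assms x_0 in simp)
qed

text \<open>
  The coefficient of L, up to sign, that couples the grid points number s and s+1, as a function of
  the point at which L is evaluated.
\<close>

definition link :: "nat \<Rightarrow> real \<Rightarrow> real" where
  "link s = (if even s then dunkl_G r1 r2 else dunkl_F \<rho>1 \<rho>2)"

lemma link_even: "even s \<Longrightarrow> link s y = (y - r1 + 1/2) * (y - r2 + 1/2) / (2 * y + 1)"
  and link_odd: "odd s \<Longrightarrow> link s y = (y - \<rho>1) * (y - \<rho>2) / (2 * y)"
  by (simp_all add: link_def dunkl_G_def dunkl_F_def)

lemma link_neg:
  assumes "s < N"
  shows "link s (x s) < 0" "link s (x (Suc s)) < 0"
proof -
  define \<sigma> where "\<sigma> = real s / 2"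
  have \<sigma>: "\<sigma> \<ge> 0" "\<sigma> \<le> (real N - 1) / 2"
    using assms by (auto simp: \<sigma>_def)
  have "link s (x s) < 0 \<and> link s (x (Suc s)) < 0"
  proof (cases "even s")
    case True
    have "link s (x s) = (e + \<sigma>) * (\<sigma> - real N / 2) / (2 * (r1 + e + \<sigma>))"
      unfolding link_even [OF True] by (simp add: x_even [OF True] r2_eq \<sigma>_def)
    moreover have "link s (x (Suc s)) = (2 * r1 + e + \<sigma>) * (2 * r1 + 2 * e + \<sigma> + real N / 2) / (- (2 * (r1 + e + \<sigma>)))"
    proof -
      have "x (Suc s) = - (r1 + e + \<sigma> + 1/2)"
        using True by (simp add: x_odd \<sigma>_def field_simps)
      moreover have "(- (r1 + e + \<sigma> + 1/2) - r1 + 1/2) * (- (r1 + e + \<sigma> + 1/2) - r2 + 1/2)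
          = (2 * r1 + e + \<sigma>) * (2 * r1 + 2 * e + \<sigma> + real N / 2)"
        unfolding r2_eq by (simp add: field_simps)
      ultimately show ?thesis
        unfolding link_even [OF True] by simp
    qed
    moreover have "(e + \<sigma>) * (\<sigma> - real N / 2) / (2 * (r1 + e + \<sigma>)) < 0"
      by (intro divide_neg_pos mult_pos_neg) (use \<sigma> r1_pos e_pos in auto)
    moreover have "(2 * r1 + e + \<sigma>) * (2 * r1 + 2 * e + \<sigma> + real N / 2) / (- (2 * (r1 + e + \<sigma>))) < 0"
      by (intro divide_pos_neg mult_pos_pos) (use \<sigma> r1_pos e_pos N_ge_2 in auto)
    ultimately show ?thesis
      by (simp only:)
  next
    case False
    have l: "link s (x s) = (r1 + e + \<sigma> + \<rho>1) * (r1 + e + \<sigma> + \<rho>2) / (- (2 * (r1 + e + \<sigma>)))"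
      unfolding link_odd [OF False] x_odd [OF False] \<sigma>_def by (simp add: algebra_simps)
    have "real N \<ge> 2"
      using N_ge_2 by simp
    moreover have "\<sigma> \<ge> 1/2"
      using odd_pos [OF False] by (simp add: \<sigma>_def)
    ultimately have pos: "r1 + e + \<sigma> + \<rho>1 > 0 \<and> r1 + e + \<sigma> + \<rho>2 > 0 \<and> r1 + e + \<sigma> > 0"
      using r1_pos e_pos d_pos unfolding \<rho>1_eq \<rho>2_eq by (intro conjI; argo)
    have "link s (x (Suc s)) = (\<sigma> - d - (real N - 1) / 2) * (\<sigma> + 1/2) / (2 * (r1 + e + \<sigma>))"
    proof -
      have a: "x (Suc s) = r1 + e + \<sigma>"
        using False by (simp add: x_even \<sigma>_def field_simps)
      have b: "r1 + e + \<sigma> - \<rho>1 = \<sigma> - d - (real N - 1) / 2" "r1 + e + \<sigma> - \<rho>2 = \<sigma> + 1/2"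
        unfolding \<rho>1_eq \<rho>2_eq by simp_all
      show ?thesis
        unfolding link_odd [OF False] a b ..
    qed
    moreover have "(\<sigma> - d - (real N - 1) / 2) * (\<sigma> + 1/2) / (2 * (r1 + e + \<sigma>)) < 0"
      by (intro divide_neg_pos mult_neg_pos) (use \<sigma> r1_pos e_pos d_pos in auto)
    ultimately show ?thesis
      using pos unfolding l by (simp only: divide_pos_neg mult_pos_pos neg_less_0_iff_less zero_less_numeral)
  qed
  then show "link s (x s) < 0" "link s (x (Suc s)) < 0"
    by auto
qed

lemma F_x_0: "dunkl_F \<rho>1 \<rho>2 (x 0) = 0"
  by (simp add: dunkl_F_def x_0)

lemma G_x_N: "dunkl_G r1 r2 (x N) = 0"
  unfolding dunkl_G_def x_even [OF even_N] r2_eq by simp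

text \<open>
  The chain does not leave the grid at its ends, because F vanishes at the first and G at the
  last point.
\<close>

lemma L_grid:
  assumes "s \<le> N"
  shows "poly (L f) (x s)
    = (if s < N then (-1) ^ s * link s (x s) * (poly f (x (Suc s)) - poly f (x s)) else 0)
    + (if 0 < s then (-1) ^ (s - 1) * link (s - 1) (x s) * (poly f (x (s - 1)) - poly f (x s)) else 0)"
proof -
  have "x s \<noteq> -1/2"
    using x_gt [of s] x_lt [of s] by (cases "even s") auto
  moreover have "x s \<noteq> 0 \<or> \<rho>1 * \<rho>2 = 0"
    using x_eq_0 by auto
  ultimately have L: "poly (L f) (x s) = shift (poly f) (x s)"
    by (rule poly_L)
  show ?thesis
  proof (cases "s = 0 \<or> s = N")
    case True
    then show ?thesis
      using N_ge_2 even_N unfolding L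
      by (auto simp: dunkl_shift_def F_x_0 G_x_N link_def x_Suc x_pred) (simp_all add: algebra_simps)
  next
    case False
    with assms show ?thesis
      unfolding L by (simp add: dunkl_shift_def link_def x_Suc x_pred) (simp add: algebra_simps)
  qed
qed

text \<open>
  Detailed balance between neighbouring points, the restriction of the symmetry of a factor to the grid.
\<close>

definition balanced :: "(nat \<Rightarrow> real) \<Rightarrow> bool" where
  "balanced w \<longleftrightarrow> (\<forall>s<N. w (Suc s) * link s (x (Suc s)) = w s * link s (x s))"

text \<open>
  Consecutive weights have a positive ratio, as the couplings between two neighbouring points have
  the same sign in both directions.
\<close>

lemma balanced_pos:
  assumes "balanced w" "w 0 > 0" "s \<le> N"
  shows "w s > 0"
  using assms(3)
proof (induction s)
  case 0
  then show ?case using assms(2) by simp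
next
  case (Suc s)
  then have "w (Suc s) * link s (x (Suc s)) < 0"
    using assms(1) link_neg [of s] by (auto simp: balanced_def mult_pos_neg)
  then show ?case
    using link_neg [of s] Suc(2) by (auto simp: mult_less_0_iff)
qed

lemma L_self_adjoint:
  assumes "balanced w"
  shows "(\<Sum>s\<le>N. w s * poly (L f) (x s) * poly h (x s)) = (\<Sum>s\<le>N. w s * poly f (x s) * poly (L h) (x s))"
proof -
  define c where "c s = (-1) ^ s * w s * link s (x s)" for s
  have *: "w s * poly (L p) (x s) = (if s < N then c s * (poly p (x (Suc s)) - poly p (x s)) else 0)
     + (if 0 < s then c (s - 1) * (poly p (x (s - 1)) - poly p (x s)) else 0)" if "s \<le> N" for s p
  proof -
    have *: "w s * link (s - 1) (x s) = w (s - 1) * link (s - 1) (x (s - 1))" if "0 < s"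
      using assms that \<open>s \<le> N\<close> by (cases s) (auto simp: balanced_def)
    have 2: "w s * ((-1) ^ (s - 1) * link (s - 1) (x s) * z) = c (s - 1) * z" if "0 < s" for z
    proof -
      have "w s * ((-1) ^ (s - 1) * link (s - 1) (x s) * z) = (-1) ^ (s - 1) * (w s * link (s - 1) (x s)) * z"
        by (simp only: mult_ac)
      also have "\<dots> = c (s - 1) * z"
        using that * unfolding c_def by (simp only: mult_ac)
      finally show ?thesis .
    qed
    have 1: "w s * ((-1) ^ s * link s (x s) * z) = c s * z" for z
      by (simp add: c_def)
    show ?thesis
      unfolding L_grid [OF that] distrib_left
      by (cases "0 < s"; cases "s < N"; simp only: if_True if_False 1 2 mult_zero_right)
  qed
  have "(\<Sum>s\<le>N. w s * poly (L f) (x s) * poly h (x s))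
     = - (\<Sum>s<N. c s * (poly f (x (Suc s)) - poly f (x s)) * (poly h (x (Suc s)) - poly h (x s)))"
    by (rule tridiagonal_sum) (rule *)
  also have "\<dots> = - (\<Sum>s<N. c s * (poly h (x (Suc s)) - poly h (x s)) * (poly f (x (Suc s)) - poly f (x s)))"
    by (simp add: mult_ac)
  also have "\<dots> = (\<Sum>s\<le>N. w s * poly (L h) (x s) * poly f (x s))"
    by (rule tridiagonal_sum [symmetric]) (rule *)
  finally show ?thesis
    by (simp add: mult_ac)
qed

lemma card_grid: "card (x ` {..N}) = Suc N"
  using inj_x by (subst card_image) (auto intro: inj_on_subset)

text \<open>
  Squared norms are positive because a nonzero polynomial of degree at most N cannot vanish at
  all N+1 grid points.
\<close>

lemma orthogonal:
  assumes "balanced w" "w 0 > 0"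
  shows "orthogonal_on_grid N x w P"
proof -
  define S where "S n m = (\<Sum>s\<le>N. w s * poly (P n) (x s) * poly (P m) (x s))" for n m
  have off: "S n m = 0" if "n \<noteq> m" for n m
  proof -
    have "ev n * S n m = ev m * S n m"
      using L_self_adjoint [OF assms(1), of "P n" "P m"]
      by (simp add: S_def L_P sum_distrib_left mult_ac)
    with that show ?thesis
      by (simp add: ev_eq_iff)
  qed
  have diag: "S n n > 0" if n: "n \<le> N" for n
  proof -
    obtain s where s: "s \<le> N" "poly (P n) (x s) \<noteq> 0"
    proof (rule ccontr)
      assume "\<not> thesis"
      then have "poly (P n) y = poly 0 y" if "y \<in> x ` {..N}" for y
        using that \<open>\<And>s. s \<le> N \<Longrightarrow> poly (P n) (x s) \<noteq> 0 \<Longrightarrow> thesis\<close> by auto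
      then have "P n = 0"
        by (rule poly_eqI_degree) (use n card_grid in auto)
      then show False
        using coeff_P [of n] by simp
    qed
    have "0 < w s * (poly (P n) (x s))\<^sup>2"
      using s balanced_pos [OF assms s(1)] by simp
    then have "0 < w s * poly (P n) (x s) * poly (P n) (x s)"
      by (simp add: power2_eq_square mult.assoc)
    then show ?thesis
      unfolding S_def
      by (intro sum_pos2 [of _ s]) (use s balanced_pos [OF assms] in \<open>auto simp: mult.assoc less_imp_le\<close>)
  qed
  show ?thesis
    unfolding orthogonal_on_grid_def S_def [symmetric]
    by (rule exI [of _ "\<lambda>n. sqrt (S n n)"]) (auto simp: off diag less_imp_le)
qed

text \<open>
  The value of L Q at a grid point involves Q only at grid points, where Q vanishes.  Hence
  L Q and Q have the same N+1 zeros, and comparing leading coefficients identifies the eigenvalue.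
\<close>

lemma P_Suc_N: "P (Suc N) = (\<Prod>s\<le>N. [:- x s, 1:])"
proof -
  define Q where "Q = (\<Prod>s\<le>N. [:- x s, 1:])"
  have Q0: "poly Q (x s) = 0" if "s \<le> N" for s
    using that by (auto simp: Q_def poly_prod)
  have deg: "degree Q = Suc N"
    unfolding Q_def by (subst degree_prod_eq_sum_degree) auto
  have lead: "coeff Q (Suc N) = 1"
    using lead_coeff_prod [of "\<lambda>s. [:- x s, 1:]" "{..N}"] deg by (simp add: Q_def)
  have "L Q = smult (ev (Suc N)) Q"
  proof (rule poly_eqI_degree_lead_coeff)
    show "coeff (L Q) (Suc N) = coeff (smult (ev (Suc N)) Q) (Suc N)"
      by (simp add: coeff_L deg)
    show "Suc N \<le> card (x ` {..N})"
      by (simp add: card_grid)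
    show "degree (L Q) \<le> Suc N"
      by (simp add: degree_L deg)
    show "degree (smult (ev (Suc N)) Q) \<le> Suc N"
      by (metis degree_smult_le deg)
    fix z assume "z \<in> x ` {..N}"
    then obtain s where s: "s \<le> N" "z = x s"
      by auto
    have "poly (L Q) (x s) = 0"
      unfolding L_grid [OF s(1)] using s(1) Q0 by simp
    then show "poly (L Q) z = poly (smult (ev (Suc N)) Q) z"
      using s Q0 by simp
  qed
  then have "Q = smult (coeff Q (Suc N)) (P (Suc N))"
    by (rule eigenvector_eq)
  with lead show ?thesis
    by (simp add: Q_def)
qed

lemma roots_P_Suc_N: "{y. poly (P (Suc N)) y = 0} = x ` {0..N}"
  by (auto simp: P_Suc_N poly_prod)

lemma symmetry_factor_balanced:
  assumes "symmetry_factor_on D r1 r2 \<rho>1 \<rho>2 \<phi>" "\<And>s. s \<le> N \<Longrightarrow> x s \<in> D"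
  shows "balanced (\<lambda>s. \<phi> (x s))"
proof -
  have "\<phi> (x (Suc s)) * link s (x (Suc s)) = \<phi> (x s) * link s (x s)" if "s < N" for s
    using that assms(1) assms(2)[of s] assms(2)[of "Suc s"]
    by (auto simp: x_Suc link_def symmetry_factor_on_def)
  then show ?thesis
    by (simp add: balanced_def)
qed

text \<open>
  Solving the balance condition along the chain gives a symmetry factor for all parameters,
  including those at which the Gamma functions have poles.
\<close>

primrec weight :: "nat \<Rightarrow> real" where
  "weight 0 = 1"
| "weight (Suc s) = weight s * link s (x s) / link s (x (Suc s))"

lemma balanced_weight: "balanced weight"
  using link_neg by (fastforce simp: balanced_def)

definition grid_factor :: "real \<Rightarrow> real" where
  "grid_factor y = (if y \<in> x ` {..N} then weight (inv x y) else 0)"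

lemma grid_factor_x: "s \<le> N \<Longrightarrow> grid_factor (x s) = weight s"
  by (auto simp: grid_factor_def inv_f_f [OF inj_x])

lemma grid_factor_off: "y \<notin> x ` {..N} \<Longrightarrow> grid_factor y = 0"
  by (simp add: grid_factor_def)

lemma balanced_grid_factor:
  "s < N \<Longrightarrow> grid_factor (x (Suc s)) * link s (x (Suc s)) = grid_factor (x s) * link s (x s)"
  using balanced_weight by (simp add: grid_factor_x balanced_def del: weight.simps)

text \<open>
  The point -x_0 lies off the grid unless \<rho>2 = 0, in which case it is x_0 = 0 itself.
\<close>

lemma grid_factor_F:
  assumes "s \<le> N"
  shows "grid_factor (- x s) * dunkl_F \<rho>1 \<rho>2 (- x s) = grid_factor (x s) * dunkl_F \<rho>1 \<rho>2 (x s)"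
proof (cases "odd s")
  case True
  with assms even_N have "s < N"
    by (metis le_neq_implies_less)
  with True show ?thesis
    using balanced_grid_factor [of s] x_Suc [of s] by (simp add: link_def)
next
  case even: False
  show ?thesis
  proof (cases s)
    case (Suc k)
    then show ?thesis
      using even assms balanced_grid_factor [of k] x_Suc [of k] by (simp add: link_def)
  next
    case 0
    have "grid_factor (- x 0) = 0" if "\<rho>2 \<noteq> 0"
    proof -
      have "- x 0 \<noteq> x i" for i
        using x_eq_uminus_\<rho>2 [of i] that x_0 by auto
      then show "grid_factor (- x 0) = 0"
        by (intro grid_factor_off) auto
    qed
    moreover have "x 0 = 0" if "\<rho>2 = 0"
      using that x_0 by simp
    ultimately show ?thesis
      using F_x_0 unfolding 0 by (cases "\<rho>2 = 0") simp_all
  qed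
qed

lemma grid_factor_G:
  assumes "s \<le> N"
  shows "grid_factor (- x s - 1) * dunkl_G r1 r2 (- x s - 1) = grid_factor (x s) * dunkl_G r1 r2 (x s)"
proof (cases "even s")
  case odd: False
  then obtain k where "s = Suc k" "even k"
    by (metis even_Suc odd_pos gr0_conv_Suc)
  then show ?thesis
    using assms balanced_grid_factor [of k] x_Suc [of k] by (simp add: link_def)
next
  case even: True
  show ?thesis
  proof (cases "s = N")
    case True
    have "- x s - 1 = x (Suc N)"
      using True even_N by (simp add: x_Suc)
    moreover have "x (Suc N) \<notin> x ` {..N}"
      using inj_x by (auto simp: inj_eq)
    ultimately show ?thesis
      using True by (simp add: grid_factor_off G_x_N)
  next
    case False
    then show ?thesis
      using even assms balanced_grid_factor [of s] x_Suc [of s] by (simp add: link_def)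
  qed
qed

lemma symmetry_factor_grid_factor: "symmetry_factor_on UNIV r1 r2 \<rho>1 \<rho>2 grid_factor"
proof -
  have "grid_factor (- y) * dunkl_F \<rho>1 \<rho>2 (- y) = grid_factor y * dunkl_F \<rho>1 \<rho>2 y" for y
  proof -
    consider s where "s \<le> N" "y = x s" | s where "s \<le> N" "- y = x s"
      | "y \<notin> x ` {..N}" "- y \<notin> x ` {..N}"
      by auto
    then show ?thesis
    proof cases
      case 1
      then show ?thesis using grid_factor_F by simp
    next
      case (2 s)
      then have "y = - x s" by simp
      then show ?thesis using grid_factor_F [OF 2(1)] by simp
    qed (simp add: grid_factor_off)
  qed
  moreover have "grid_factor (- y - 1) * dunkl_G r1 r2 (- y - 1) = grid_factor y * dunkl_G r1 r2 y" for y
  proof -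
    consider s where "s \<le> N" "y = x s" | s where "s \<le> N" "- y - 1 = x s"
      | "y \<notin> x ` {..N}" "- y - 1 \<notin> x ` {..N}"
      by auto
    then show ?thesis
    proof cases
      case 1
      then show ?thesis using grid_factor_G by simp
    next
      case (2 s)
      then have "y = - x s - 1" by simp
      then show ?thesis using grid_factor_G [OF 2(1)] by simp
    qed (simp add: grid_factor_off)
  qed
  ultimately show ?thesis
    by (simp add: symmetry_factor_on_def)
qed

end

section \<open>The Gamma function weight\<close>

text \<open>
  The reciprocal Gamma function is entire and satisfies its functional equation everywhere, so
  the denominators need no regularity assumption.
\<close>

lemma bi_gamma_factor_eq_rGamma:
  "bi_gamma_factor \<sigma> r1 r2 \<rho>1 \<rho>2 y =
     - 2 * \<sigma> y *
       (Gamma (\<rho>1 - y) * Gamma (y - r1 + 1/2) * Gamma (- y - r1 + 1/2) * Gamma (y + 1 + \<rho>1)) *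
       (rGamma (y + 1 - \<rho>2) * rGamma (y + r2 + 1/2) * rGamma (r2 + 1/2 - y) * rGamma (- y - \<rho>2))"
  unfolding bi_gamma_factor_def by (simp only: rGamma_inverse_Gamma divide_inverse inverse_mult_distrib)

text \<open>
  The factor x - \<rho>1 is absorbed by \<Gamma>(\<rho>1 - x) and x - \<rho>2 by 1/\<Gamma>(x + 1 - \<rho>2).  On the
  right-hand side all brackets, and \<sigma>(y)/y, are invariant under y \<mapsto> -y.
\<close>

lemma bi_gamma_factor_F:
  assumes "\<rho>1 - y \<notin> \<int>\<^sub>\<le>\<^sub>0"
  shows "bi_gamma_factor \<sigma> r1 r2 \<rho>1 \<rho>2 y * dunkl_F \<rho>1 \<rho>2 y =
     \<sigma> y / y * (Gamma (\<rho>1 - y + 1) * Gamma (\<rho>1 + y + 1)) * (Gamma (y - r1 + 1/2) * Gamma (- y - r1 + 1/2))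
       * (rGamma (r2 + 1/2 + y) * rGamma (r2 + 1/2 - y)) * (rGamma (y - \<rho>2) * rGamma (- y - \<rho>2))"
proof -
  have 1: "Gamma (\<rho>1 - y + 1) = (\<rho>1 - y) * Gamma (\<rho>1 - y)"
    by (rule Gamma_plus1 [OF assms])
  have 2: "rGamma (y - \<rho>2) = (y - \<rho>2) * rGamma (y + 1 - \<rho>2)"
    using rGamma_plus1 [of "y - \<rho>2"] by (simp add: algebra_simps)
  have 3: "y + r2 + 1/2 = r2 + 1/2 + y" "y + 1 + \<rho>1 = \<rho>1 + y + 1"
    by simp_all
  show ?thesis
    unfolding bi_gamma_factor_eq_rGamma 1 2 3 dunkl_F_def
    by (cases "y = 0") (simp_all add: field_simps)
qed

text \<open>
  Here the factors of G are absorbed by \<Gamma>(y - r1 + 1/2) and 1/\<Gamma>(r2 + 1/2 - y), after which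
  all brackets are invariant under y \<mapsto> -y-1.
\<close>

lemma bi_gamma_factor_G:
  assumes "y - r1 + 1/2 \<notin> \<int>\<^sub>\<le>\<^sub>0"
  shows "bi_gamma_factor \<sigma> r1 r2 \<rho>1 \<rho>2 y * dunkl_G r1 r2 y =
     2 * \<sigma> y / (2 * y + 1) * (Gamma (\<rho>1 - y) * Gamma (\<rho>1 + y + 1))
       * (Gamma (y - r1 + 3/2) * Gamma (- y - r1 + 1/2))
       * (rGamma (r2 + 1/2 + y) * rGamma (r2 - 1/2 - y)) * (rGamma (y + 1 - \<rho>2) * rGamma (- y - \<rho>2))"
proof -
  have 1: "Gamma (y - r1 + 3/2) = (y - r1 + 1/2) * Gamma (y - r1 + 1/2)"
    using Gamma_plus1 [OF assms] by (simp add: algebra_simps)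
  have 2: "rGamma (r2 - 1/2 - y) = (r2 - 1/2 - y) * rGamma (r2 + 1/2 - y)"
    using rGamma_plus1 [of "r2 - 1/2 - y"] by (simp add: algebra_simps)
  have 3: "y + r2 + 1/2 = r2 + 1/2 + y" "y + 1 + \<rho>1 = \<rho>1 + y + 1"
    by simp_all
  define q where "q = inverse (2 * y + 1)"
  have 4: "y - r2 + 1/2 = - (r2 - 1/2 - y)"
    by simp
  have G: "dunkl_G r1 r2 y = (y - r1 + 1/2) * - (r2 - 1/2 - y) * q"
    unfolding dunkl_G_def q_def divide_inverse [of _ "2 * y + 1"] 4 ..
  show ?thesis
    unfolding bi_gamma_factor_eq_rGamma 1 2 3 G divide_inverse [of _ "2 * y + 1"] q_def [symmetric]
    by (simp only: mult_ac mult_minus_left mult_minus_right minus_minus)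
qed

lemma symmetry_factor_gamma:
  assumes "odd_one_periodic \<sigma>"
  shows "symmetry_factor_on (bi_gamma_regular r1 \<rho>1) r1 r2 \<rho>1 \<rho>2 (bi_gamma_factor \<sigma> r1 r2 \<rho>1 \<rho>2)"
  unfolding symmetry_factor_on_def
proof (intro conjI ballI impI)
  have odd: "\<sigma> (- y) = - \<sigma> y" and per: "\<sigma> (y + 1) = \<sigma> y" for y
    using assms by (auto simp: odd_one_periodic_def)
  fix y
  assume y: "y \<in> bi_gamma_regular r1 \<rho>1"
  show "bi_gamma_factor \<sigma> r1 r2 \<rho>1 \<rho>2 (- y) * dunkl_F \<rho>1 \<rho>2 (- y)
      = bi_gamma_factor \<sigma> r1 r2 \<rho>1 \<rho>2 y * dunkl_F \<rho>1 \<rho>2 y" if "- y \<in> bi_gamma_regular r1 \<rho>1"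
  proof -
    have *: "\<rho>1 - y \<notin> \<int>\<^sub>\<le>\<^sub>0" "\<rho>1 - - y \<notin> \<int>\<^sub>\<le>\<^sub>0"
      using y that unfolding bi_gamma_regular_def by blast+
    show ?thesis
      unfolding bi_gamma_factor_F [OF *(1)] bi_gamma_factor_F [OF *(2)]
      by (simp add: odd mult_ac)
  qed
  show "bi_gamma_factor \<sigma> r1 r2 \<rho>1 \<rho>2 (- y - 1) * dunkl_G r1 r2 (- y - 1)
      = bi_gamma_factor \<sigma> r1 r2 \<rho>1 \<rho>2 y * dunkl_G r1 r2 y" if "- y - 1 \<in> bi_gamma_regular r1 \<rho>1"
  proof -
    have *: "y - r1 + 1/2 \<notin> \<int>\<^sub>\<le>\<^sub>0" "(- y - 1) - r1 + 1/2 \<notin> \<int>\<^sub>\<le>\<^sub>0"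
      using y that unfolding bi_gamma_regular_def by blast+
    have s: "\<sigma> (- y - 1) = - \<sigma> y"
      using odd [of "y + 1"] per [of y] by simp
    have q: "2 * - \<sigma> y / (2 * (- y - 1) + 1) = 2 * \<sigma> y / (2 * y + 1)"
    proof -
      have "2 * (- y - 1) + 1 = - (2 * y + 1)" by simp
      then show ?thesis
        by (simp only: mult_minus_right minus_divide_divide)
    qed
    have e: "\<rho>1 - (- y - 1) = \<rho>1 + y + 1" "\<rho>1 + (- y - 1) + 1 = \<rho>1 - y"
      "- y - 1 - r1 + 3/2 = - y - r1 + 1/2" "- (- y - 1) - r1 + 1/2 = y - r1 + 3/2"
      "r2 + 1/2 + (- y - 1) = r2 - 1/2 - y" "r2 - 1/2 - (- y - 1) = r2 + 1/2 + y"
      "- y - 1 + 1 - \<rho>2 = - y - \<rho>2" "- (- y - 1) - \<rho>2 = y + 1 - \<rho>2"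
      by simp_all
    show ?thesis
      unfolding bi_gamma_factor_G [OF *(1)] bi_gamma_factor_G [OF *(2)] s q e
      by (simp only: mult_ac)
  qed
qed

lemma odd_one_periodic_add_nat:
  assumes "odd_one_periodic \<sigma>"
  shows "\<sigma> (y + real k) = \<sigma> y"
proof (induction k)
  case (Suc k)
  have "\<sigma> (y + real k + 1) = \<sigma> (y + real k)"
    using assms by (simp add: odd_one_periodic_def)
  with Suc show ?case
    by (simp add: algebra_simps)
qed simp

lemma odd_one_periodic_sin: "odd_one_periodic (\<lambda>y. c * sin (2 * pi * y))"
  using sin_periodic [of "2 * pi * y" for y] by (simp add: odd_one_periodic_def distrib_left)

context dunkl_grid
begin

lemma odd_one_periodic_x:
  assumes "odd_one_periodic \<sigma>"
  shows "\<sigma> (x s) = (-1) ^ s * \<sigma> (x 0)"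
proof (cases "even s")
  case True
  then obtain k where "s = 2 * k" by (auto elim!: evenE)
  then have "x s = \<rho>2 + real k"
    by (simp add: bi_grid_def)
  then show ?thesis
    using True odd_one_periodic_add_nat [OF assms] by (simp add: x_0)
next
  case False
  then obtain k where "s = 2 * k + 1" by (auto elim!: oddE)
  then have "x s = - (\<rho>2 + real (Suc k))"
    by (simp add: bi_grid_def field_simps)
  moreover have "\<sigma> (- (\<rho>2 + real (Suc k))) = - \<sigma> (\<rho>2 + real (Suc k))"
    using assms unfolding odd_one_periodic_def by blast
  ultimately show ?thesis
    using False odd_one_periodic_add_nat [OF assms, of \<rho>2 "Suc k"] by (simp add: x_0)
qed

lemma pos_notin_nonpos_Ints: "(y :: real) > 0 \<Longrightarrow> y \<notin> \<int>\<^sub>\<le>\<^sub>0"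
  using nonpos_Ints_nonpos by fastforce

lemma reflect_notin_nonpos_Ints:
  fixes y z :: real
  assumes "y \<notin> \<int>" "z = - y + of_int k"
  shows "z \<notin> \<int>\<^sub>\<le>\<^sub>0"
proof
  assume "z \<in> \<int>\<^sub>\<le>\<^sub>0"
  then have "of_int k - z \<in> \<int>"
    using nonpos_Ints_Int by auto
  with assms show False
    by simp
qed

text \<open>
  At each grid point a single Gamma argument in the numerator can fail to be positive, and it is
  an integer minus (2 r1 + e).
\<close>

lemma x_in_gamma_regular:
  assumes "2 * r1 + e \<notin> \<int>" "s \<le> N"
  shows "x s \<in> bi_gamma_regular r1 \<rho>1"
proof (cases "even s")
  case True
  then obtain k where k: "s = 2 * k" by (auto elim!: evenE)
  have x: "x s = r1 + e - 1/2 + real k"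
    unfolding x_even [OF True] by (simp add: k)
  have kN: "2 * real k \<le> real N"
    using assms(2) by (simp add: k flip: of_nat_mult)
  have "\<rho>1 - x s \<notin> \<int>\<^sub>\<le>\<^sub>0" "x s - r1 + 1/2 \<notin> \<int>\<^sub>\<le>\<^sub>0" "x s + 1 + \<rho>1 \<notin> \<int>\<^sub>\<le>\<^sub>0"
    by (rule pos_notin_nonpos_Ints; use kN r1_pos e_pos d_pos in \<open>simp add: x \<rho>1_eq field_simps\<close>)+
  moreover have "- x s - r1 + 1/2 \<notin> \<int>\<^sub>\<le>\<^sub>0"
    by (rule reflect_notin_nonpos_Ints [OF assms(1), of _ "1 - int k"]) (simp add: x)
  ultimately show ?thesis
    by (simp add: bi_gamma_regular_def)
next
  case False
  then obtain k where k: "s = 2 * k + 1" by (auto elim!: oddE)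
  have x: "x s = - (r1 + e + 1/2 + real k)"
    unfolding x_odd [OF False] by (simp add: k field_simps)
  have kN: "2 * real k + 1 \<le> real N"
    using assms(2) by (simp add: k flip: of_nat_mult of_nat_Suc)
  have "\<rho>1 - x s \<notin> \<int>\<^sub>\<le>\<^sub>0" "- x s - r1 + 1/2 \<notin> \<int>\<^sub>\<le>\<^sub>0" "x s + 1 + \<rho>1 \<notin> \<int>\<^sub>\<le>\<^sub>0"
    by (rule pos_notin_nonpos_Ints; use kN r1_pos e_pos d_pos in \<open>simp add: x \<rho>1_eq field_simps\<close>)+
  moreover have "x s - r1 + 1/2 \<notin> \<int>\<^sub>\<le>\<^sub>0"
    by (rule reflect_notin_nonpos_Ints [OF assms(1), of _ "- int k"]) (simp add: x)
  ultimately show ?thesis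
    by (simp add: bi_gamma_regular_def)
qed

lemma gamma_factor_x_0:
  assumes "2 * r1 + e \<notin> \<int>" "2 * r1 + 2 * e \<notin> \<int>"
  obtains K where "K \<noteq> 0" "\<And>\<sigma>. bi_gamma_factor \<sigma> r1 r2 \<rho>1 \<rho>2 (x 0) = \<sigma> (x 0) * K"
proof
  let ?K = "bi_gamma_factor (\<lambda>_. 1) r1 r2 \<rho>1 \<rho>2 (x 0)"
  show "bi_gamma_factor \<sigma> r1 r2 \<rho>1 \<rho>2 (x 0) = \<sigma> (x 0) * ?K" for \<sigma>
    by (simp add: bi_gamma_factor_def)
  have x0: "x 0 = r1 + e - 1/2"
    by (simp add: x_even)
  have "x 0 + 1 - \<rho>2 \<notin> \<int>\<^sub>\<le>\<^sub>0" "x 0 + r2 + 1/2 \<notin> \<int>\<^sub>\<le>\<^sub>0" "r2 + 1/2 - x 0 \<notin> \<int>\<^sub>\<le>\<^sub>0"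
    unfolding x0 by (rule pos_notin_nonpos_Ints; use r1_pos e_pos in \<open>simp add: r2_eq \<rho>2_eq\<close>)+
  moreover have "- x 0 - \<rho>2 \<notin> \<int>\<^sub>\<le>\<^sub>0"
    unfolding x0 by (rule reflect_notin_nonpos_Ints [OF assms(2), of _ 1]) (simp add: \<rho>2_eq)
  ultimately show "?K \<noteq> 0"
    using x_in_gamma_regular [OF assms(1), of 0]
    by (simp add: bi_gamma_factor_def bi_gamma_regular_def Gamma_eq_zero_iff)
qed

text \<open>
  The sine of period 1 vanishes only at half-integers, and 2 x_0 = 2 r1 + 2 e - 1 is not an integer.
\<close>

lemma ex_odd_one_periodic:
  assumes "2 * r1 + 2 * e \<notin> \<int>" "\<eta> \<noteq> 0"
  obtains \<sigma> where "odd_one_periodic \<sigma>" "\<eta> * \<sigma> (x 0) > 0"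
proof -
  let ?c = "sin (2 * pi * x 0)"
  have "2 * x 0 \<notin> \<int>"
  proof
    assume "2 * x 0 \<in> \<int>"
    then have "2 * x 0 + 1 \<in> \<int>" by (intro Ints_add) simp_all
    with assms(1) show False by (simp add: x_even)
  qed
  then have "?c \<noteq> 0"
    using sin_times_pi_eq_0 [of "2 * x 0"] by (simp add: mult_ac)
  then have "0 < \<eta>\<^sup>2 * ?c\<^sup>2"
    using assms(2) by simp
  then have "\<eta> * (\<eta> * ?c * sin (2 * pi * x 0)) > 0"
    by (simp add: power2_eq_square mult_ac)
  with odd_one_periodic_sin show ?thesis
    by (rule that)
qed

end

section \<open>The finite orthogonality relation\<close>

theorem mainTheorem11:
  fixes N :: nat and r1 r2 \<rho>1 \<rho>2 e d :: real
    and P :: "nat \<Rightarrow> real poly" and u :: "nat \<Rightarrow> real" and x :: "nat \<Rightarrow> real"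
  assumes N: "even N" "N \<ge> 2"
    and pos: "r1 > 0" "e > 0" "d > 0"
    and r2: "r2 = r1 + e + real N / 2"
    and \<rho>1: "\<rho>1 = r1 + e + d + (real N - 1) / 2"
    and \<rho>2: "\<rho>2 = r1 + e - 1/2"
    and P: "P = bannai_ito r1 r2 \<rho>1 \<rho>2"
    and u: "u = bi_u r1 r2 \<rho>1 \<rho>2"
    and x: "x = bi_grid \<rho>2"
  shows
    "2 * (r2 - \<rho>2) = real N + 1
     \<and> (\<forall>n. \<exists>!p. is_bannai_ito r1 r2 \<rho>1 \<rho>2 n p)
     \<and> (\<exists>b. \<forall>n. P (Suc n) + smult (b n) (P n) + (if n = 0 then 0 else smult (u n) (P (n - 1)))
                 = [:0, 1:] * P n)
     \<and> (\<forall>n\<in>{1..N}. even n \<longrightarrow>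
          u n = real n * (real n + 4 * r1 - 2 + 4 * e + 2 * d + real N)
                  * (- real n + 4 * r1 + 2 * e + real N) * (real n - 2 + 2 * e + 2 * d)
                / (16 * (real n - 1 + e + d)\<^sup>2))
     \<and> (\<forall>n\<in>{1..N}. odd n \<longrightarrow>
          u n = (real n - 1 + 2 * e + 2 * d + real N) * (real n - 1 + 2 * d)
                  * (real n - 1 + 2 * e) * (- real n + 1 + real N)
                / (16 * (real n - 1 + e + d)\<^sup>2))
     \<and> (\<forall>n\<in>{1..N}. u n > 0)
     \<and> u (N + 1) = 0
     \<and> inj_on x {0..N}
     \<and> {t. poly (P (N + 1)) t = 0} = x ` {0..N}
     \<and> (\<exists>\<phi>. symmetry_factor_on UNIV r1 r2 \<rho>1 \<rho>2 \<phi>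
            \<and> (\<forall>s\<le>N. \<phi> (x s) > 0)
            \<and> orthogonal_on_grid N x (\<lambda>s. \<phi> (x s)) P)
     \<and> (2 * r1 + e \<notin> \<int> \<and> 2 * r1 + 2 * e \<notin> \<int> \<longrightarrow>
          (\<exists>\<eta>\<in>{- 1, 1 :: real}.
             (\<exists>\<sigma>. odd_one_periodic \<sigma> \<and> \<eta> * \<sigma> (x 0) > 0)
             \<and> (\<forall>\<sigma>. odd_one_periodic \<sigma> \<longrightarrow>
                  (\<forall>s\<le>N. x s \<in> bi_gamma_regular r1 \<rho>1)
                  \<and> symmetry_factor_on (bi_gamma_regular r1 \<rho>1) r1 r2 \<rho>1 \<rho>2
                       (bi_gamma_factor \<sigma> r1 r2 \<rho>1 \<rho>2)
                  \<and> (\<forall>s\<le>N. \<sigma> (x s) = (- 1) ^ s * \<sigma> (x 0))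
                  \<and> (\<eta> * \<sigma> (x 0) > 0 \<longrightarrow>
                       (\<forall>s\<le>N. bi_gamma_factor \<sigma> r1 r2 \<rho>1 \<rho>2 (x s) > 0)
                       \<and> orthogonal_on_grid N x
                            (\<lambda>s. bi_gamma_factor \<sigma> r1 r2 \<rho>1 \<rho>2 (x s)) P))))"
proof -
  interpret dunkl_grid r1 r2 \<rho>1 \<rho>2 N e d
    by unfold_locales (use assms in auto)
  have g: "\<rho>1 + \<rho>2 - r1 - r2 = e + d - 1"
    unfolding r2 \<rho>1 \<rho>2 by (simp add: field_simps)
  have u_even: "u n = real n * (real n + 4 * r1 - 2 + 4 * e + 2 * d + real N)
                  * (- real n + 4 * r1 + 2 * e + real N) * (real n - 2 + 2 * e + 2 * d)
                / (16 * (real n - 1 + e + d)\<^sup>2)" if "even n" for n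
  proof -
    have eqs: "real n + 2 * \<rho>1 + 2 * \<rho>2 = real n + 4 * r1 - 2 + 4 * e + 2 * d + real N"
      "real n - 2 * r1 - 2 * r2 = - (- real n + 4 * r1 + 2 * e + real N)"
      "real n + 2 * (e + d - 1) = real n - 2 + 2 * e + 2 * d" "real n + (e + d - 1) = real n - 1 + e + d"
      unfolding r2 \<rho>1 \<rho>2 by (simp_all add: distrib_left right_diff_distrib add_divide_distrib diff_divide_distrib)
    show ?thesis
      unfolding u bi_u_def Let_def g eqs
      using that by (simp only: if_True if_False mult_minus_left mult_minus_right minus_minus)
  qed
  have u_odd: "u n = (real n - 1 + 2 * e + 2 * d + real N) * (real n - 1 + 2 * d)
                  * (real n - 1 + 2 * e) * (- real n + 1 + real N)
                / (16 * (real n - 1 + e + d)\<^sup>2)" if "odd n" for n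
  proof -
    have eqs: "real n + 2 * \<rho>1 - 2 * r1 = real n - 1 + 2 * e + 2 * d + real N"
      "real n + 2 * \<rho>1 - 2 * r2 = real n - 1 + 2 * d"
      "real n + 2 * \<rho>2 - 2 * r1 = real n - 1 + 2 * e"
      "real n + 2 * \<rho>2 - 2 * r2 = - (- real n + 1 + real N)" "real n + (e + d - 1) = real n - 1 + e + d"
      unfolding r2 \<rho>1 \<rho>2 by (simp_all add: distrib_left right_diff_distrib add_divide_distrib diff_divide_distrib)
    show ?thesis
      unfolding u bi_u_def Let_def g eqs
      using that by (simp only: if_True if_False mult_minus_left mult_minus_right minus_minus)
  qed
  have u_pos: "u n > 0" if n: "n \<in> {1..N}" for n
  proof (cases "even n")
    case True
    with n have "real n \<ge> 2" "real n \<le> real N"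
      by (auto elim!: evenE)
    then show ?thesis
      unfolding u_even [OF True] using pos by (intro divide_pos_pos mult_pos_pos zero_less_power) auto
  next
    case False
    with n have "real n \<ge> 1" "real n \<le> real N"
      by auto
    then show ?thesis
      unfolding u_odd [OF False] using pos by (intro divide_pos_pos mult_pos_pos zero_less_power) auto
  qed
  have u_N: "u (N + 1) = 0"
    using u_odd [of "N + 1"] N by simp
  have "\<exists>b. P (Suc n) + smult b (P n) + (if n = 0 then 0 else smult (u n) (P (n - 1))) = [:0, 1:] * P n" for n
  proof (cases n)
    case 0
    \<comment> \<open>For n = 0 the recurrence only says that P 1 is monic of degree 1.\<close>
    have "P 1 + smult (- coeff (P 1) 0) (P 0) = [:0, 1:]"
    proof (rule poly_eqI)
      fix k
      have "coeff (P 1) k = 0" if "k > 1"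
        unfolding P by (rule coeff_eq_0) (use that in simp)
      moreover have "coeff (P 1) 1 = 1"
        unfolding P by simp
      ultimately show "coeff (P 1 + smult (- coeff (P 1) 0) (P 0)) k = coeff [:0, 1:] k"
        by (cases k; cases "k - 1") (auto simp: P P_0)
    qed
    then show ?thesis
      using 0 by (auto simp: P P_0)
  next
    case (Suc m)
    then show ?thesis
      using recurrence [of m] unfolding P u by (auto simp: ac_simps)
  qed
  then have recurrence: "\<exists>b. \<forall>n. P (Suc n) + smult (b n) (P n)
      + (if n = 0 then 0 else smult (u n) (P (n - 1))) = [:0, 1:] * P n"
    by metis
  have weight: "\<exists>\<phi>. symmetry_factor_on UNIV r1 r2 \<rho>1 \<rho>2 \<phi> \<and> (\<forall>s\<le>N. \<phi> (x s) > 0)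
      \<and> orthogonal_on_grid N x (\<lambda>s. \<phi> (x s)) P"
  proof (intro exI conjI)
    have bal: "balanced (\<lambda>s. grid_factor (x s))"
      unfolding x using symmetry_factor_grid_factor by (rule symmetry_factor_balanced) simp
    moreover have 0: "grid_factor (x 0) > 0"
      unfolding x by (simp add: grid_factor_x)
    ultimately show "\<forall>s\<le>N. grid_factor (x s) > 0"
      using balanced_pos by blast
    show "orthogonal_on_grid N x (\<lambda>s. grid_factor (x s)) P"
      using orthogonal bal 0 unfolding x P .
  qed (rule symmetry_factor_grid_factor)
  have gamma: "\<exists>\<eta>\<in>{- 1, 1 :: real}.
             (\<exists>\<sigma>. odd_one_periodic \<sigma> \<and> \<eta> * \<sigma> (x 0) > 0)
             \<and> (\<forall>\<sigma>. odd_one_periodic \<sigma> \<longrightarrow>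
                  (\<forall>s\<le>N. x s \<in> bi_gamma_regular r1 \<rho>1)
                  \<and> symmetry_factor_on (bi_gamma_regular r1 \<rho>1) r1 r2 \<rho>1 \<rho>2
                       (bi_gamma_factor \<sigma> r1 r2 \<rho>1 \<rho>2)
                  \<and> (\<forall>s\<le>N. \<sigma> (x s) = (- 1) ^ s * \<sigma> (x 0))
                  \<and> (\<eta> * \<sigma> (x 0) > 0 \<longrightarrow>
                       (\<forall>s\<le>N. bi_gamma_factor \<sigma> r1 r2 \<rho>1 \<rho>2 (x s) > 0)
                       \<and> orthogonal_on_grid N x
                            (\<lambda>s. bi_gamma_factor \<sigma> r1 r2 \<rho>1 \<rho>2 (x s)) P))"
    if int: "2 * r1 + e \<notin> \<int>" "2 * r1 + 2 * e \<notin> \<int>"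
  proof -
    obtain K where K: "K \<noteq> 0" "\<And>\<sigma>. bi_gamma_factor \<sigma> r1 r2 \<rho>1 \<rho>2 (x 0) = \<sigma> (x 0) * K"
      by (rule gamma_factor_x_0 [OF int, folded x]) (rule that)
    show ?thesis
    \<comment> \<open>The sign of the periodic factor must match that of the Gamma product K at the first point.\<close>
    proof (intro bexI [of _ "sgn K"] conjI allI impI)
      show "sgn K \<in> {- 1, 1}"
        using K(1) by (auto simp: sgn_if)
      show "\<exists>\<sigma>. odd_one_periodic \<sigma> \<and> sgn K * \<sigma> (x 0) > 0"
        using ex_odd_one_periodic [OF int(2), of "sgn K"] K(1) unfolding x by (metis sgn_eq_0_iff)
      fix \<sigma> assume \<sigma>: "odd_one_periodic \<sigma>"
      show reg: "x s \<in> bi_gamma_regular r1 \<rho>1" if "s \<le> N" for s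
        unfolding x by (rule x_in_gamma_regular [OF int(1) that])
      show sym: "symmetry_factor_on (bi_gamma_regular r1 \<rho>1) r1 r2 \<rho>1 \<rho>2 (bi_gamma_factor \<sigma> r1 r2 \<rho>1 \<rho>2)"
        by (rule symmetry_factor_gamma [OF \<sigma>])
      show "\<sigma> (x s) = (- 1) ^ s * \<sigma> (x 0)" for s
        unfolding x by (rule odd_one_periodic_x [OF \<sigma>])
      have bal: "balanced (\<lambda>s. bi_gamma_factor \<sigma> r1 r2 \<rho>1 \<rho>2 (x s))"
        unfolding x using sym by (rule symmetry_factor_balanced) (rule reg [unfolded x])
      assume "sgn K * \<sigma> (x 0) > 0"
      then have 0: "bi_gamma_factor \<sigma> r1 r2 \<rho>1 \<rho>2 (x 0) > 0"
        unfolding K(2) by (auto simp: sgn_if zero_less_mult_iff split: if_splits)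
      show "bi_gamma_factor \<sigma> r1 r2 \<rho>1 \<rho>2 (x s) > 0" if "s \<le> N" for s
        using balanced_pos [OF bal 0 that] .
      show "orthogonal_on_grid N x (\<lambda>s. bi_gamma_factor \<sigma> r1 r2 \<rho>1 \<rho>2 (x s)) P"
        using orthogonal bal 0 unfolding x P .
    qed
  qed
  show ?thesis
  proof (intro conjI ballI impI)
    show "2 * (r2 - \<rho>2) = real N + 1"
      unfolding r2 \<rho>2 by simp
    show "\<forall>n. \<exists>!p. is_bannai_ito r1 r2 \<rho>1 \<rho>2 n p"
      using ex1_bannai_ito by blast
    show "inj_on x {0..N}"
      unfolding x using inj_x by (rule inj_on_subset) simp
    show "{t. poly (P (N + 1)) t = 0} = x ` {0..N}"
      using roots_P_Suc_N unfolding P x by simp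
  qed (use recurrence u_even u_odd u_pos u_N weight gamma in blast)+
qed

end
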